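(* Let $t\geq 14$ and $n\geq t$ be integers and let $0<p\leq\frac{1}{t+1}$. If $\mathcal{A}\subset 2^{[n]}$ and $\mathcal{B}\subset 2^{[n]}$ are cross $t$-intersecting, then $$\mu_p(\mathcal{A})\mu_p(\mathcal{B})\leq p^{2t}.$$ Equality holds if and only if either $\mathcal{A}=\mathcal{B}\cong\mathcal{F}_0^t(n)$, or $p=\frac{1}{t+1}$ and $\mathcal{A}=\mathcal{B}\cong\mathcal{F}_1^t(n)$.
   Context: $2^{[n]}$ is the power set of $[n]=\{1,\dots,n\}$. For $F\subset[n]$, $\mu_p(F)=p^{|F|}(1-p)^{n-|F|}$, and for $\mathcal{F}\subset 2^{[n]}$, $\mu_p(\mathcal{F})=\sum_{F\in\mathcal{F}}\mu_p(F)$. Families are cross $t$-intersecting if $|A\cap B|\ge t$ for all $A\in\mathcal{A},B\in\mathcal{B}$. $\mathcal{F}_i^t(n)=\{F\subset[n]:|F\cap[t+2i]|\geq t+i\}$. Two families $\mathcal{A},\mathcal{B}\subset 2^{[n]}$ are isomorphic ($\mathcal{A}\cong\mathcal{B}$) if there is a permutation $f$ of $[n]$ with $\mathcal{A}=\{\{f(b):b\in B\}:B\in\mathcal{B}\}$.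
   Formalization: The second equality case additionally requires n ≥ t+2, so that [t+2] lies in [n]; for n = t or t+1 and p = 1/(t+1) the set formula gives F_1^t(n) empty or {[t+1]}, whose product of measures is not p^{2t}, so the equality claim as printed fails there. *)

theory Defs
  imports Complex_Main "HOL-Combinatorics.Permutations"
begin

definition weight :: "nat \<Rightarrow> real \<Rightarrow> nat set \<Rightarrow> real" where
  "weight n p F = p ^ card F * (1 - p) ^ (n - card F)"

definition mu :: "nat \<Rightarrow> real \<Rightarrow> nat set set \<Rightarrow> real" where
  "mu n p \<F> = (\<Sum>F\<in>\<F>. weight n p F)"

definition cross_intersecting :: "nat \<Rightarrow> nat set set \<Rightarrow> nat set set \<Rightarrow> bool" where
  "cross_intersecting t \<A> \<B> \<longleftrightarrow> (\<forall>A\<in>\<A>. \<forall>B\<in>\<B>. t \<le> card (A \<inter> B))"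

text \<open>The Frankl family with parameter \<open>i\<close>. It is meaningful only if \<open>t + 2 * i \<le> n\<close>,
  so that the window \<open>{1..t + 2 * i}\<close> lies inside the ground set \<open>{1..n}\<close>.\<close>

definition frankl_family :: "nat \<Rightarrow> nat \<Rightarrow> nat \<Rightarrow> nat set set" where
  "frankl_family t i n = {F. F \<subseteq> {1..n} \<and> t + i \<le> card (F \<inter> {1..t + 2 * i})}"

definition isomorphic_families :: "nat \<Rightarrow> nat set set \<Rightarrow> nat set set \<Rightarrow> bool" where
  "isomorphic_families n \<A> \<B> \<longleftrightarrow> (\<exists>f. f permutes {1..n} \<and> \<A> = {f ` B |B. B \<in> \<B>})"

end

theory Submission imports Defs "HOL-Analysis.Convex" begin

text \<open>Read a set \<open>F \<subseteq> {1..n}\<close> as a walk that goes up at the times in \<open>F\<close> and down otherwise. For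
  shifted cross \<open>t\<close>-intersecting families, any two walks have heights summing to at least \<open>2 * t\<close>
  at some time. Hence, if all walks of \<open>\<A>\<close> reach height \<open>u\<close> and all walks of \<open>\<B>\<close> reach \<open>v\<close>,
  with \<open>u\<close> and \<open>v\<close> maximal, then \<open>u + v \<ge> 2 * t\<close>. Reaching height \<open>u\<close> has probability at most
  \<open>\<alpha> ^ u\<close> with \<open>\<alpha> = p / (1 - p)\<close>, which settles \<open>u + v > 2 * t\<close>, and reaching it twice has
  probability at most \<open>2 * p * \<alpha> ^ u\<close>. So one may assume that both families contain a walk that
  attains its bound once and does not exceed it. This forces all walks that do not exceed their
  bound to attain it at one common time \<open>T\<close>, i.e. to have fixed cardinality on \<open>{1..T}\<close>. All but
  the windows of the Frankl families are then excluded numerically, and there a set outside the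
  window in one family excludes a much larger set of walks from the other one.

  Up-closed families satisfy \<open>mu n (p powr s) \<F> \<le> mu n p \<F> powr s\<close> for \<open>s \<ge> 1\<close>, which reduces
  everything to \<open>p = 1 / (t + 1)\<close>. Uniqueness is traced back through the shifts: the minimal sets
  of a Frankl family determine the families before the shift.\<close>

subsection \<open>Random walks and supermartingales\<close>

text \<open>The obstacle is a constant factor. At p = 1/(t+1), with q = 1 - p, one has t p = q, so
  \<alpha> = 1/t and \<alpha>^(2t) = p^(2t) / q^(2t): the bound by hitting probabilities overshoots
  the target by q^(-2t), which is close to e^2. Each case must win this factor back. An excess u + v
  > 2t gains 1/t, a second visit gains 2p, and 2/(t+1) < e^(-2) holds for integers exactly from t =
  14 on. When both families have a walk with a single visit, binomial point probabilities replace
  hitting probabilities. This is still too weak for windows of size at most t + 2, because the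
  identity p^2 + (t+2) p q = (p+q)^2 = 1 makes F_1 tie with F_0. There one compares what a family
  gains outside its window with what the other one loses inside. The critical p is settled with
  strict inequality unless both families are windows: strictness survives taking powers, whereas a
  mere bound would not identify the extremal families for smaller p.\<close>

definition height :: "nat set \<Rightarrow> nat \<Rightarrow> int" where
  "height F l = 2 * int (card (F \<inter> {1..l})) - int l"

lemma height_0 [simp]: "height F 0 = 0"
  by (simp add: height_def)

lemma height_insert_old: "m \<le> l \<Longrightarrow> height (insert (Suc l) F) m = height F m"
proof -
  assume "m \<le> l"
  then have "insert (Suc l) F \<inter> {1..m} = F \<inter> {1..m}" by auto
  then show ?thesis by (simp add: height_def)
qed

lemma height_insert_new:
  assumes "F \<subseteq> {1..l}"
  shows "height (insert (Suc l) F) (Suc l) = height F l + 1"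
proof -
  have "insert (Suc l) F \<inter> {1..Suc l} = insert (Suc l) (F \<inter> {1..l})"
    using assms by auto
  then show ?thesis by (simp add: height_def)
qed

lemma height_stay:
  assumes "F \<subseteq> {1..l}"
  shows "height F (Suc l) = height F l - 1"
proof -
  have "F \<inter> {1..Suc l} = F \<inter> {1..l}" using assms by auto
  then show ?thesis by (simp add: height_def)
qed

lemma weight_insert:
  assumes "F \<subseteq> {1..l}"
  shows "weight (Suc l) p (insert (Suc l) F) = p * weight l p F"
proof -
  have "finite F" "Suc l \<notin> F" using assms finite_subset by auto
  then show ?thesis by (simp add: weight_def)
qed

lemma weight_stay:
  assumes "F \<subseteq> {1..l}"
  shows "weight (Suc l) p F = (1 - p) * weight l p F"
proof -
  have "card F \<le> l" using card_mono[OF _ assms] by simp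
  then show ?thesis by (simp add: weight_def Suc_diff_le)
qed

lemma weight_nonneg: "0 \<le> p \<Longrightarrow> p \<le> 1 \<Longrightarrow> 0 \<le> weight n p F"
  by (simp add: weight_def)

lemma weight_pos: "0 < p \<Longrightarrow> p < 1 \<Longrightarrow> 0 < weight n p F"
  by (simp add: weight_def)

text \<open>Extend the prefix one element at a time; \<open>step\<close> says that the conditional
  expectation does not increase. \<open>V\<close> may depend on the whole set, not only on its
  height, so that past events of the walk can be recorded in it.\<close>

lemma weight_supermartingale:
  fixes V :: "nat \<Rightarrow> nat set \<Rightarrow> real"
  assumes "0 \<le> p" "p \<le> 1" "W \<le> n" "C \<subseteq> {1..W}"
    and step: "\<And>l F. W \<le> l \<Longrightarrow> F \<subseteq> {1..l} \<Longrightarrow> F \<inter> {1..W} = C \<Longrightarrow>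
      p * V (Suc l) (insert (Suc l) F) + (1 - p) * V (Suc l) F \<le> V l F"
  shows "(\<Sum>F | F \<subseteq> {1..n} \<and> F \<inter> {1..W} = C. weight n p F * V n F) \<le> weight W p C * V W C"
  using \<open>W \<le> n\<close>
proof (induction n rule: dec_induct)
  case base
  have "{F. F \<subseteq> {1..W} \<and> F \<inter> {1..W} = C} = {C}" using \<open>C \<subseteq> {1..W}\<close> by auto
  then show ?case by simp
next
  case (step n)
  let ?X = "\<lambda>n. {F. F \<subseteq> {1..n} \<and> F \<inter> {1..W} = C}"
  have fin: "finite (?X n)" by (rule finite_subset[of _ "Pow {1..n}"]) auto
  have eq: "?X (Suc n) = ?X n \<union> insert (Suc n) ` ?X n"
  proof (intro equalityI subsetI)
    fix F assume F: "F \<in> ?X (Suc n)"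
    show "F \<in> ?X n \<union> insert (Suc n) ` ?X n"
    proof (cases "Suc n \<in> F")
      case True
      have "F - {Suc n} \<subseteq> {1..n}" using F by (auto simp: atLeastAtMostSuc_conv)
      moreover have "(F - {Suc n}) \<inter> {1..W} = C" using F \<open>W \<le> n\<close> by auto
      ultimately have "F - {Suc n} \<in> ?X n" by simp
      moreover have "F = insert (Suc n) (F - {Suc n})" using True by auto
      ultimately show ?thesis by blast
    next
      case False
      then have "F \<subseteq> {1..n}" using F by (auto simp: subset_iff) (metis le_SucE)
      then show ?thesis using F by simp
    qed
  next
    fix F assume "F \<in> ?X n \<union> insert (Suc n) ` ?X n"
    then show "F \<in> ?X (Suc n)" using \<open>W \<le> n\<close> by auto
  qed
  have disj: "?X n \<inter> insert (Suc n) ` ?X n = {}" by auto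
  have inj: "inj_on (insert (Suc n)) (?X n)"
  proof (rule inj_onI)
    fix F G assume "F \<in> ?X n" "G \<in> ?X n" "insert (Suc n) F = insert (Suc n) G"
    moreover have "Suc n \<notin> F" "Suc n \<notin> G" using calculation by auto
    ultimately show "F = G" by (metis insert_ident)
  qed
  have "(\<Sum>F\<in>?X (Suc n). weight (Suc n) p F * V (Suc n) F)
      = (\<Sum>F\<in>?X n. weight (Suc n) p F * V (Suc n) F)
      + (\<Sum>F\<in>?X n. weight (Suc n) p (insert (Suc n) F) * V (Suc n) (insert (Suc n) F))"
    unfolding eq using fin disj
    by (subst sum.union_disjoint) (auto simp only: sum.reindex[OF inj] o_def)
  also have "\<dots> = (\<Sum>F\<in>?X n. weight n p F *
      (p * V (Suc n) (insert (Suc n) F) + (1 - p) * V (Suc n) F))"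
    unfolding sum.distrib[symmetric]
    by (rule sum.cong) (simp_all add: weight_insert weight_stay algebra_simps)
  also have "\<dots> \<le> (\<Sum>F\<in>?X n. weight n p F * V n F)"
    using step.hyps assms(1,2)
    by (intro sum_mono mult_left_mono weight_nonneg) (auto intro!: assms(5))
  also have "\<dots> \<le> weight W p C * V W C" by (rule step.IH)
  finally show ?case .
qed

text \<open>The constants 1 and -1 both satisfy the step condition, which gives the two
  inequalities.\<close>

lemma weight_cylinder:
  assumes "0 \<le> p" "p \<le> 1" "W \<le> n" "C \<subseteq> {1..W}"
  shows "(\<Sum>F | F \<subseteq> {1..n} \<and> F \<inter> {1..W} = C. weight n p F) = weight W p C"
proof (rule antisym)
  show "(\<Sum>F | F \<subseteq> {1..n} \<and> F \<inter> {1..W} = C. weight n p F) \<le> weight W p C"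
    using weight_supermartingale[OF assms, of "\<lambda>_ _. 1"] by simp
  show "weight W p C \<le> (\<Sum>F | F \<subseteq> {1..n} \<and> F \<inter> {1..W} = C. weight n p F)"
    using weight_supermartingale[OF assms, of "\<lambda>_ _. - 1"] by (simp add: sum_negf)
qed

section \<open>The product measure of families and of cylinders\<close>

lemma finite_family: "\<A> \<subseteq> Pow {1..n::nat} \<Longrightarrow> finite \<A>"
  by (rule finite_subset) auto

lemma mu_nonneg: "0 \<le> p \<Longrightarrow> p \<le> 1 \<Longrightarrow> 0 \<le> mu n p \<A>"
  unfolding mu_def by (intro sum_nonneg weight_nonneg)

lemma mu_mono:
  assumes "0 \<le> p" "p \<le> 1" "\<B> \<subseteq> Pow {1..n}" "\<A> \<subseteq> \<B>"
  shows "mu n p \<A> \<le> mu n p \<B>"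
  unfolding mu_def using assms finite_family
  by (intro sum_mono2) (auto intro: weight_nonneg)

lemma mu_eq_imp_eq:
  assumes "0 < p" "p < 1" "\<B> \<subseteq> Pow {1..n}" "\<A> \<subseteq> \<B>" "mu n p \<B> \<le> mu n p \<A>"
  shows "\<A> = \<B>"
proof (rule ccontr)
  assume "\<A> \<noteq> \<B>"
  then obtain F where "F \<in> \<B>" "F \<notin> \<A>" using assms(4) by auto
  then have "mu n p \<A> < mu n p \<B>"
    unfolding mu_def using assms finite_family weight_pos[of p] weight_nonneg[of p]
    by (intro sum_strict_mono2[where b = F]) auto
  with assms(5) show False by simp
qed

lemma mu_union_le:
  assumes "0 \<le> p" "p \<le> 1" "\<A> \<subseteq> Pow {1..n}" "\<B> \<subseteq> Pow {1..n}"
  shows "mu n p (\<A> \<union> \<B>) \<le> mu n p \<A> + mu n p \<B>"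
proof -
  have "mu n p (\<A> \<union> \<B>) + mu n p (\<A> \<inter> \<B>) = mu n p \<A> + mu n p \<B>"
    unfolding mu_def using finite_family[OF assms(3)] finite_family[OF assms(4)]
    by (rule sum.union_inter)
  then show ?thesis using mu_nonneg[OF assms(1,2)] by (smt (verit))
qed

lemma mu_cylinder:
  assumes "0 \<le> p" "p \<le> 1" "W \<le> n" "\<C> \<subseteq> Pow {1..W}"
  shows "mu n p {F. F \<subseteq> {1..n} \<and> F \<inter> {1..W} \<in> \<C>} = mu W p \<C>"
proof -
  let ?X = "{F. F \<subseteq> {1..n} \<and> F \<inter> {1..W} \<in> \<C>}"
  have fin: "finite ?X" "finite \<C>" using finite_family[of _ n] finite_family[OF assms(4)] by auto
  have "mu n p ?X = (\<Sum>C\<in>\<C>. \<Sum>F | F \<in> ?X \<and> F \<inter> {1..W} = C. weight n p F)"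
    unfolding mu_def using fin by (intro sum.group[symmetric]) auto
  also have "\<dots> = (\<Sum>C\<in>\<C>. weight W p C)"
  proof (rule sum.cong[OF refl])
    fix C assume "C \<in> \<C>"
    then have "{F. F \<in> ?X \<and> F \<inter> {1..W} = C} = {F. F \<subseteq> {1..n} \<and> F \<inter> {1..W} = C}" by auto
    then show "(\<Sum>F | F \<in> ?X \<and> F \<inter> {1..W} = C. weight n p F) = weight W p C"
      using weight_cylinder[OF assms(1-3)] \<open>C \<in> \<C>\<close> assms(4) by auto
  qed
  finally show ?thesis by (simp add: mu_def)
qed

lemma mu_level:
  assumes "k \<le> n"
  shows "mu n p {F. F \<subseteq> {1..n} \<and> card F = k} = real (n choose k) * p ^ k * (1 - p) ^ (n - k)"
proof -
  have "mu n p {F. F \<subseteq> {1..n} \<and> card F = k} = (\<Sum>F | F \<subseteq> {1..n} \<and> card F = k. p ^ k * (1 - p) ^ (n - k))"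
    unfolding mu_def by (rule sum.cong) (auto simp: weight_def)
  then show ?thesis by (simp add: n_subsets)
qed

section \<open>Hitting probabilities\<close>

lemma alpha_harmonic:
  fixes p a :: real
  assumes "0 < p" "p < 1" "a = p / (1 - p)"
  shows "p * a ^ d + (1 - p) * a ^ Suc (Suc d) = a ^ Suc d"
proof -
  have ap: "(1 - p) * a = p" using assms by simp
  have "p * a ^ d + (1 - p) * a ^ Suc (Suc d) = (1 - p) * a * a ^ d + (1 - p) * a * a ^ Suc d"
    by (simp only: ap) (use ap in simp)
  also have "\<dots> = p * a ^ d + p * (a * a ^ d)" by (simp only: ap power_Suc)
  also have "\<dots> = ((1 - p) * a + p * a) * a ^ d" unfolding ap by (simp add: distrib_right)
  also have "\<dots> = a ^ Suc d" by (simp add: left_diff_distrib)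
  finally show ?thesis .
qed

text \<open>Gambler's ruin: 1 and \<open>a\<close> are the roots of (1 - p) x^2 - x + p = 0, and a^d
  is the probability that an infinite walk ever climbs by d; a finite walk can only do worse.
  Truncation by \<open>nat\<close> gives exponent 0 if the prefix is already high enough.\<close>

lemma reach_from:
  assumes p: "0 < p" "p \<le> 1/2" and a: "a = p / (1 - p)" and "W \<le> n" "C \<subseteq> {1..W}"
  shows "mu n p {F. F \<subseteq> {1..n} \<and> F \<inter> {1..W} = C \<and> (\<exists>l\<in>{W..n}. c \<le> height F l)}
    \<le> weight W p C * a ^ nat (c - height C W)"
proof -
  define hit where "hit l F \<longleftrightarrow> (\<exists>m\<in>{W..l}. c \<le> height F m)" for l F
  \<comment> \<open>Once the level is hit, the value is frozen at 1, whatever the walk does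
    later.\<close>
  define V where "V l F = (if hit l F then 1 else a ^ nat (c - height F l))" for l F
  have a01: "0 \<le> a" "a \<le> 1" using p a by auto
  have V1: "0 \<le> V l F" "V l F \<le> 1" for l F unfolding V_def using a01 by (auto simp: power_le_one)
  have step: "p * V (Suc l) (insert (Suc l) F) + (1 - p) * V (Suc l) F \<le> V l F"
    if l: "W \<le> l" "F \<subseteq> {1..l}" for l F
  proof (cases "hit l F")
    case True
    have "p * V (Suc l) (insert (Suc l) F) + (1 - p) * V (Suc l) F \<le> p * 1 + (1 - p) * 1"
      using p V1 by (intro add_mono mult_left_mono) auto
    then show ?thesis using True by (simp add: V_def)
  next
    case False
    then have lt: "height F l < c" using l by (force simp: hit_def)
    define d where "d = nat (c - height F l - 1)"
    have d: "nat (c - height F l) = Suc d" using lt d_def by simp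
    have nohit: "\<not> hit (Suc l) F"
      using False l lt by (auto simp: hit_def le_Suc_eq height_stay)
    have Vs: "V (Suc l) F = a ^ Suc (Suc d)"
    proof -
      have "nat (c - (height F l - 1)) = Suc (Suc d)" using lt d_def by simp
      then show ?thesis using nohit by (simp only: V_def height_stay[OF l(2)] if_False)
    qed
    have Vi: "V (Suc l) (insert (Suc l) F) = a ^ d"
    proof (cases "hit (Suc l) (insert (Suc l) F)")
      case True
      then have "c \<le> height F l + 1"
        using False l by (auto simp: hit_def le_Suc_eq height_insert_new height_insert_old)
      then have "d = 0" using lt d_def by simp
      then show ?thesis using True by (simp add: V_def)
    next
      case False
      have "nat (c - (height F l + 1)) = d" by (simp add: d_def)
      then show ?thesis using False by (simp add: V_def height_insert_new[OF l(2)])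
    qed
    have "V l F = a ^ Suc d" using False d by (simp add: V_def)
    then show ?thesis using alpha_harmonic[of p a d] p a unfolding Vs Vi by simp
  qed
  have "mu n p {F. F \<subseteq> {1..n} \<and> F \<inter> {1..W} = C \<and> hit n F}
      = (\<Sum>F | F \<subseteq> {1..n} \<and> F \<inter> {1..W} = C \<and> hit n F. weight n p F * V n F)"
    unfolding mu_def by (rule sum.cong) (auto simp: V_def)
  also have "\<dots> \<le> (\<Sum>F | F \<subseteq> {1..n} \<and> F \<inter> {1..W} = C. weight n p F * V n F)"
    using p V1 finite_family[of _ n] by (intro sum_mono2) (auto intro!: mult_nonneg_nonneg weight_nonneg)
  also have "\<dots> \<le> weight W p C * V W C"
    using p step assms(4,5) by (intro weight_supermartingale) auto
  also have "V W C = a ^ nat (c - height C W)"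
    by (auto simp: V_def hit_def)
  finally show ?thesis by (simp add: hit_def)
qed

definition reaching :: "nat \<Rightarrow> nat \<Rightarrow> nat set set" where
  "reaching n u = {F. F \<subseteq> {1..n} \<and> (\<exists>l\<le>n. int u \<le> height F l)}"

lemma mu_reaching:
  assumes "0 < p" "p \<le> 1/2"
  shows "mu n p (reaching n u) \<le> (p / (1 - p)) ^ u"
  using reach_from[OF assms refl, of 0 n "{}" "int u"]
  by (simp add: reaching_def weight_def atLeast0AtMost Bex_def)

lemma mu_reaching_twice:
  assumes p: "0 < p" "p \<le> 1/2"
  shows "mu n p {F. F \<subseteq> {1..n} \<and> (\<exists>k l. k < l \<and> l \<le> n \<and> int u \<le> height F k \<and> int u \<le> height F l)}
    \<le> 2 * p * (p / (1 - p)) ^ u"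
proof -
  define a where "a = p / (1 - p)"
  define one where "one l F \<longleftrightarrow> (\<exists>m\<le>l. int u \<le> height F m)" for l F
  define two where "two l F \<longleftrightarrow> (\<exists>k m. k < m \<and> m \<le> l \<and> int u \<le> height F k \<and> int u \<le> height F m)" for l F
  \<comment> \<open>\<open>V l F\<close> is the probability that the infinite walk starting with \<open>F\<close> is at height at least
    \<open>u\<close> twice: a walk at height \<open>u\<close> for the first time returns with probability \<open>p + (1 - p) * a = 2 * p\<close>.\<close>
  define V where "V l F =
    (if two l F \<or> int u < height F l then 1
     else if one l F then (if int u \<le> height F l then 2 * p else a ^ nat (int u - height F l))
     else 2 * p * a ^ nat (int u - height F l))" for l F
  have a01: "0 \<le> a" "a \<le> 1" using p a_def by auto
  have ap: "(1 - p) * a = p" using p a_def by simp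
  have "2 * p * a ^ d \<le> 1" for d
    using mult_mono[of "2 * p" 1 "a ^ d" 1] a01 p by (simp add: power_le_one)
  then have V1: "0 \<le> V l F" "V l F \<le> 1" for l F
    unfolding V_def using a01 p by (auto simp: power_le_one)
  have step: "p * V (Suc l) (insert (Suc l) F) + (1 - p) * V (Suc l) F \<le> V l F"
    if F: "F \<subseteq> {1..l}" for l F
  proof -
    note hts = height_stay[OF F] height_insert_new[OF F] height_insert_old
    have old_iff: "k < m \<and> m \<le> l \<and> int u \<le> height (insert (Suc l) F) k \<and>
        int u \<le> height (insert (Suc l) F) m \<longleftrightarrow>
        k < m \<and> m \<le> l \<and> int u \<le> height F k \<and> int u \<le> height F m" for k m
      by (auto simp: height_insert_old)
    have old: "one l (insert (Suc l) F) \<longleftrightarrow> one l F" "two l (insert (Suc l) F) \<longleftrightarrow> two l F"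
      unfolding two_def old_iff by (auto simp: one_def height_insert_old)
    have one_Suc: "one (Suc l) G \<longleftrightarrow> one l G \<or> int u \<le> height G (Suc l)" for G
      by (auto simp: one_def le_Suc_eq)
    have two_Suc: "two (Suc l) G \<longleftrightarrow> two l G \<or> one l G \<and> int u \<le> height G (Suc l)" for G
    proof -
      have "k < m \<and> m \<le> Suc l \<and> Q k \<and> Q m \<longleftrightarrow>
          k < m \<and> m \<le> l \<and> Q k \<and> Q m \<or> m = Suc l \<and> k \<le> l \<and> Q k \<and> Q m" for k m Q
        by auto
      from this[of _ _ "\<lambda>m. int u \<le> height G m"] show ?thesis
        unfolding two_def one_def by blast
    qed
    have one_s: "one (Suc l) F \<longleftrightarrow> one l F \<or> int u \<le> height F l - 1"
      by (simp add: one_Suc hts)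
    have one_i: "one (Suc l) (insert (Suc l) F) \<longleftrightarrow> one l F \<or> int u \<le> height F l + 1"
      by (simp add: one_Suc hts old)
    have two_s: "two (Suc l) F \<longleftrightarrow> two l F \<or> one l F \<and> int u \<le> height F l - 1"
      by (simp add: two_Suc hts)
    have two_i: "two (Suc l) (insert (Suc l) F) \<longleftrightarrow> two l F \<or> one l F \<and> int u \<le> height F l + 1"
      by (simp add: two_Suc hts old)
    have cur: "int u \<le> height F l \<Longrightarrow> one l F" by (auto simp: one_def)
    show ?thesis
    \<comment> \<open>A walk above \<open>u\<close> was at height at least \<open>u\<close> one step
      earlier, since it starts at 0 and climbs by ones; so 1 is the right value there too.\<close>
    proof (cases "two l F \<or> int u < height F l")
      case True
      have "p * V (Suc l) (insert (Suc l) F) + (1 - p) * V (Suc l) F \<le> p * 1 + (1 - p) * 1"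
        using p V1 by (intro add_mono mult_left_mono) auto
      then show ?thesis using True by (simp add: V_def)
    next
      case nt: False
      show ?thesis
      proof (cases "int u = height F l")
        case True
        have Vi: "V (Suc l) (insert (Suc l) F) = 1"
          using True by (simp add: V_def hts)
        have Vs: "V (Suc l) F = a"
          using True nt cur by (simp add: V_def hts two_s one_s)
        have "V l F = 2 * p" using True nt cur by (simp add: V_def)
        then show ?thesis using ap by (simp add: Vi Vs)
      next
        case False
        then have lt: "height F l < int u" using nt by simp
        define d where "d = nat (int u - height F l - 1)"
        have d0: "nat (int u - height F l) = Suc d" "nat (int u - (height F l - 1)) = Suc (Suc d)"
          "nat (int u - (height F l + 1)) = d"
          using lt d_def by simp_all
        have deq: "int u = height F l + 1 \<longleftrightarrow> d = 0" using lt d_def by auto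
        \<comment> \<open>Before and after the first visit the value has the same form up to the
          factor \<open>k\<close>. This also fits for d = 0: arriving at \<open>u\<close> gives 1 at
          a second visit and 2 * p at the first.\<close>
        define k where "k = (if one l F then 1 else 2 * p)"
        have Vl: "V l F = k * a ^ Suc d" using nt lt d0 by (simp add: V_def k_def)
        have Vs: "V (Suc l) F = k * a ^ Suc (Suc d)"
          using nt lt d0 by (simp add: V_def k_def hts two_s one_s)
        have Vi: "V (Suc l) (insert (Suc l) F) = k * a ^ d"
          using nt lt d0 deq by (auto simp: V_def k_def hts two_i one_i)
        have "p * (k * a ^ d) + (1 - p) * (k * a ^ Suc (Suc d)) = k * (p * a ^ d + (1 - p) * a ^ Suc (Suc d))"
          by (simp only: algebra_simps)
        also have "\<dots> = k * a ^ Suc d" using alpha_harmonic[of p a d] p a_def by simp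
        finally show ?thesis by (simp add: Vl Vs Vi)
      qed
    qed
  qed
  have "mu n p {F. F \<subseteq> {1..n} \<and> two n F}
      = (\<Sum>F | F \<subseteq> {1..n} \<and> two n F. weight n p F * V n F)"
    unfolding mu_def by (rule sum.cong) (auto simp: V_def)
  also have "\<dots> \<le> (\<Sum>F | F \<subseteq> {1..n} \<and> F \<inter> {1..0} = {}. weight n p F * V n F)"
    using p V1 finite_family[of _ n] by (intro sum_mono2) (auto intro!: mult_nonneg_nonneg weight_nonneg)
  also have "\<dots> \<le> weight 0 p {} * V 0 {}"
    using p step by (intro weight_supermartingale) auto
  also have "\<dots> = 2 * p * a ^ u"
    by (auto simp: V_def two_def one_def weight_def)
  finally show ?thesis by (simp add: two_def a_def)
qed

subsection \<open>Shifting\<close>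

definition swap_elem :: "nat \<Rightarrow> nat \<Rightarrow> nat set \<Rightarrow> nat set" where
  "swap_elem x y F = insert x (F - {y})"

definition shift_set :: "nat \<Rightarrow> nat \<Rightarrow> nat set set \<Rightarrow> nat set \<Rightarrow> nat set" where
  "shift_set x y \<A> F =
    (if y \<in> F \<and> x \<notin> F \<and> swap_elem x y F \<notin> \<A> then swap_elem x y F else F)"

definition shift :: "nat \<Rightarrow> nat \<Rightarrow> nat set set \<Rightarrow> nat set set" where
  "shift x y \<A> = shift_set x y \<A> ` \<A>"

definition shifted :: "nat \<Rightarrow> nat set set \<Rightarrow> bool" where
  "shifted n \<A> \<longleftrightarrow> (\<forall>x y F. 1 \<le> x \<longrightarrow> x < y \<longrightarrow> y \<le> n \<longrightarrow> F \<in> \<A> \<longrightarrow> y \<in> F \<longrightarrow> x \<notin> F \<longrightarrow>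
    swap_elem x y F \<in> \<A>)"

lemma card_swap_elem:
  assumes "finite F" "y \<in> F" "x \<notin> F"
  shows "card (swap_elem x y F) = card F"
  using assms by (simp add: swap_elem_def card_Diff_singleton)
    (metis Suc_pred card_gt_0_iff empty_iff)

lemma card_shift_set: "finite F \<Longrightarrow> card (shift_set x y \<A> F) = card F"
  by (simp add: shift_set_def card_swap_elem)

text \<open>A moved set lands outside \<A>, so it cannot collide with a set that stays; two moved
  sets are recovered from their images.\<close>

lemma inj_on_shift_set: "inj_on (shift_set x y \<A>) \<A>"
proof (rule inj_onI)
  fix F G assume FG: "F \<in> \<A>" "G \<in> \<A>" and eq: "shift_set x y \<A> F = shift_set x y \<A> G"
  show "F = G"
  proof (cases "F = shift_set x y \<A> F \<or> G = shift_set x y \<A> G")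
    case True
    then show ?thesis using FG eq by (auto simp: shift_set_def split: if_splits)
  next
    case False
    then have "y \<in> F" "x \<notin> F" "y \<in> G" "x \<notin> G" "swap_elem x y F = swap_elem x y G"
      using eq by (auto simp: shift_set_def split: if_splits)
    then show ?thesis unfolding swap_elem_def by (metis Diff_insert_absorb insert_Diff insertE Diff_iff)
  qed
qed

lemma shift_subset:
  assumes "\<A> \<subseteq> Pow {1..n}" "x \<in> {1..n}"
  shows "shift x y \<A> \<subseteq> Pow {1..n}"
  using assms by (auto simp: shift_def shift_set_def swap_elem_def split: if_splits)

lemma card_shift: "card (shift x y \<A>) = card \<A>"
  unfolding shift_def by (rule card_image[OF inj_on_shift_set])

lemma mu_shift:
  assumes "\<A> \<subseteq> Pow {1..n}"
  shows "mu n p (shift x y \<A>) = mu n p \<A>"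
proof -
  have "mu n p (shift x y \<A>) = (\<Sum>F\<in>\<A>. weight n p (shift_set x y \<A> F))"
    unfolding mu_def shift_def by (simp add: sum.reindex[OF inj_on_shift_set])
  also have "\<dots> = mu n p \<A>"
    unfolding mu_def
  proof (rule sum.cong[OF refl])
    fix F assume "F \<in> \<A>"
    then have "finite F" using assms finite_subset[of F "{1..n}"] by auto
    then show "weight n p (shift_set x y \<A> F) = weight n p F"
      by (simp add: weight_def card_shift_set)
  qed
  finally show ?thesis .
qed

lemma cross_intersecting_sym:
  "cross_intersecting t \<A> \<B> \<Longrightarrow> cross_intersecting t \<B> \<A>"
  unfolding cross_intersecting_def by (metis Int_commute)

text \<open>A loss of \<open>y\<close> from the intersection is compensated: either the image of
  \<open>G\<close> contains \<open>x\<close>, or \<open>G\<close> stayed because its swap already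
  lies in \<B>, and then the bound for \<open>F\<close> and that swap is the one required.\<close>

lemma shift_set_inter:
  assumes "cross_intersecting t \<A> \<B>" "F \<in> \<A>" "G \<in> \<B>" "finite F" "x \<noteq> y"
    and moved: "y \<in> F" "x \<notin> F"
  shows "t \<le> card (swap_elem x y F \<inter> shift_set x y \<B> G)"
proof -
  have FG: "t \<le> card (F \<inter> G)" using assms by (auto simp: cross_intersecting_def)
  have *: "card (insert x (F \<inter> G - {y})) = card (F \<inter> G)" if "y \<in> G"
    using card_swap_elem[of "F \<inter> G" y x] that assms by (simp add: swap_elem_def)
  show ?thesis
  proof (cases "y \<in> G")
    case False
    then have "F \<inter> G \<subseteq> swap_elem x y F \<inter> shift_set x y \<B> G"
      by (auto simp: shift_set_def swap_elem_def)
    then have "card (F \<inter> G) \<le> card (swap_elem x y F \<inter> shift_set x y \<B> G)"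
      using \<open>finite F\<close> by (intro card_mono) (auto simp: swap_elem_def)
    then show ?thesis using FG by simp
  next
    case yG: True
    show ?thesis
    proof (cases "x \<in> G \<or> swap_elem x y G \<notin> \<B>")
      case True
      then have "swap_elem x y F \<inter> shift_set x y \<B> G = insert x (F \<inter> G - {y})"
        using yG \<open>x \<noteq> y\<close> moved by (auto simp: shift_set_def swap_elem_def)
      then show ?thesis using *[OF yG] FG by simp
    next
      case False
      then have "t \<le> card (F \<inter> swap_elem x y G)" using assms by (auto simp: cross_intersecting_def)
      moreover have "F \<inter> swap_elem x y G = swap_elem x y F \<inter> shift_set x y \<B> G"
        using False yG moved by (auto simp: shift_set_def swap_elem_def)
      ultimately show ?thesis by simp
    qed
  qed
qed

lemma cross_intersecting_shift:
  assumes cr: "cross_intersecting t \<A> \<B>" and fin: "\<A> \<subseteq> Pow {1..n}" "\<B> \<subseteq> Pow {1..n}" and "x \<noteq> y"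
  shows "cross_intersecting t (shift x y \<A>) (shift x y \<B>)"
  unfolding cross_intersecting_def shift_def
proof (intro ballI, elim imageE, hypsubst)
  fix F G assume FG: "F \<in> \<A>" "G \<in> \<B>"
  have fF: "finite F" "finite G" using FG fin finite_subset[of _ "{1..n}"] by auto
  consider "shift_set x y \<A> F = F" "shift_set x y \<B> G = G"
    | "y \<in> F" "x \<notin> F" "shift_set x y \<A> F = swap_elem x y F"
    | "y \<in> G" "x \<notin> G" "shift_set x y \<B> G = swap_elem x y G"
    unfolding shift_set_def by presburger
  then show "t \<le> card (shift_set x y \<A> F \<inter> shift_set x y \<B> G)"
  proof cases
    case 1
    then show ?thesis using cr FG by (simp add: cross_intersecting_def)
  next
    case 2
    then show ?thesis using shift_set_inter[OF cr FG fF(1) \<open>x \<noteq> y\<close>] by simp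
  next
    case 3
    then show ?thesis
      using shift_set_inter[OF cross_intersecting_sym[OF cr] FG(2,1) fF(2) \<open>x \<noteq> y\<close>]
      by (simp add: Int_commute)
  qed
qed

lemma sum_swap_elem:
  assumes "finite F" "y \<in> F" "x \<notin> F" "x < y"
  shows "\<Sum>(swap_elem x y F) < \<Sum>F"
proof -
  have "\<Sum>F = y + \<Sum>(F - {y})" using assms by (simp add: sum.remove)
  then show ?thesis using assms by (simp add: swap_elem_def)
qed

text \<open>The sum of all elements of all sets is the potential on which the induction over shifts
  runs.\<close>

lemma sum_shift:
  assumes "\<A> \<subseteq> Pow {1..n}" "x < y"
  shows "(\<Sum>F\<in>shift x y \<A>. \<Sum>F) \<le> (\<Sum>F\<in>\<A>. \<Sum>F)"
    and "F \<in> \<A> \<Longrightarrow> y \<in> F \<Longrightarrow> x \<notin> F \<Longrightarrow> swap_elem x y F \<notin> \<A> \<Longrightarrow>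
      (\<Sum>F\<in>shift x y \<A>. \<Sum>F) < (\<Sum>F\<in>\<A>. \<Sum>F)"
proof -
  have eq: "(\<Sum>F\<in>shift x y \<A>. \<Sum>F) = (\<Sum>F\<in>\<A>. \<Sum>(shift_set x y \<A> F))"
    unfolding shift_def by (simp add: sum.reindex[OF inj_on_shift_set])
  have fin: "finite F" if "F \<in> \<A>" for F using that assms finite_subset[of F "{1..n}"] by auto
  have le: "\<Sum>(shift_set x y \<A> F) \<le> \<Sum>F" if "F \<in> \<A>" for F
    using sum_swap_elem[OF fin[OF that] _ _ \<open>x < y\<close>] by (auto simp: shift_set_def)
  show "(\<Sum>F\<in>shift x y \<A>. \<Sum>F) \<le> (\<Sum>F\<in>\<A>. \<Sum>F)"
    unfolding eq by (rule sum_mono[OF le])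
  assume F: "F \<in> \<A>" "y \<in> F" "x \<notin> F" "swap_elem x y F \<notin> \<A>"
  then have "\<Sum>(shift_set x y \<A> F) < \<Sum>F"
    using sum_swap_elem[OF fin[OF F(1)] _ _ \<open>x < y\<close>] by (simp add: shift_set_def)
  then show "(\<Sum>F\<in>shift x y \<A>. \<Sum>F) < (\<Sum>F\<in>\<A>. \<Sum>F)"
    unfolding eq using finite_family[OF assms(1)] le F(1) by (intro sum_strict_mono_ex1) auto
qed

lemma shift_memD:
  assumes "H \<in> shift x y \<A>"
  shows "H \<in> \<A> \<or> x \<in> H \<and> y \<notin> H \<and> swap_elem y x H \<in> \<A>"
proof -
  obtain F where F: "F \<in> \<A>" "H = shift_set x y \<A> F" using assms by (auto simp: shift_def)
  show ?thesis
  proof (cases "H = F")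
    case False
    then have "y \<in> F" "x \<notin> F" "H = swap_elem x y F" using F by (auto simp: shift_set_def split: if_splits)
    moreover from this have "swap_elem y x H = F" by (auto simp: swap_elem_def)
    ultimately show ?thesis using F(1) by (auto simp: swap_elem_def)
  qed (use F in simp)
qed

text \<open>A set with \<open>y\<close> but without \<open>x\<close> is never the image of a moved
  set, so it stayed, and it stayed only because its swap was already in the family.\<close>

lemma shift_memD2:
  assumes "H \<in> shift x y \<A>" "y \<in> H" "x \<notin> H"
  shows "H \<in> \<A>" "swap_elem x y H \<in> \<A>"
proof -
  obtain F where F: "F \<in> \<A>" "H = shift_set x y \<A> F" using assms by (auto simp: shift_def)
  then show "H \<in> \<A>" "swap_elem x y H \<in> \<A>"
    using assms(2,3) by (auto simp: shift_set_def swap_elem_def split: if_splits)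
qed

subsection \<open>Families determined by a window\<close>

text \<open>Frankl families over an arbitrary window \<open>Y\<close>. Isomorphism to a Frankl
  family becomes the choice of \<open>Y\<close>, and no permutation has to be carried through the
  shifts. The additive form avoids truncated subtraction.\<close>

definition window_family :: "nat \<Rightarrow> nat \<Rightarrow> nat set \<Rightarrow> nat set set" where
  "window_family n k Y = {F. F \<subseteq> {1..n} \<and> card Y \<le> card (F \<inter> Y) + k}"

lemma ex_permutes_image:
  assumes "Y \<subseteq> {1..n}" "card Y = T" "T \<le> n"
  shows "\<exists>f. f permutes {1..n} \<and> f ` {1..T} = Y"
proof -
  have fin: "finite Y" using assms(1) finite_subset by auto
  obtain g where g: "bij_betw g {1..T} Y"
    using finite_same_card_bij[of "{1..T}" Y] fin assms(2) by auto
  have "card ({1..n} - {1..T}) = card ({1..n} - Y)"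
    using assms fin by (simp add: card_Diff_subset)
  then obtain h where h: "bij_betw h ({1..n} - {1..T}) ({1..n} - Y)"
    using finite_same_card_bij[of "{1..n} - {1..T}" "{1..n} - Y"] by auto
  define f where "f x = (if x \<in> {1..T} then g x else if x \<in> {1..n} then h x else x)" for x
  have "bij_betw f {1..T} Y" using g by (rule bij_betw_cong[THEN iffD1, rotated]) (simp add: f_def)
  moreover have "bij_betw f ({1..n} - {1..T}) ({1..n} - Y)"
    using h by (rule bij_betw_cong[THEN iffD1, rotated]) (simp add: f_def)
  ultimately have "bij_betw f ({1..T} \<union> ({1..n} - {1..T})) (Y \<union> ({1..n} - Y))"
    by (rule bij_betw_combine) auto
  moreover have "{1..T} \<union> ({1..n} - {1..T}) = {1..n}" "Y \<union> ({1..n} - Y) = {1..n}"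
    using assms by auto
  ultimately have "bij_betw f {1..n} {1..n}" by simp
  then have "f permutes {1..n}" by (rule bij_imp_permutes) (use assms(3) in \<open>auto simp: f_def\<close>)
  moreover have "f ` {1..T} = Y" using \<open>bij_betw f {1..T} Y\<close> by (simp add: bij_betw_def)
  ultimately show ?thesis by blast
qed

lemma image_window_family:
  assumes f: "f permutes {1..n}" and "finite Y"
  shows "window_family n k (f ` Y) = image f ` window_family n k Y"
proof -
  have inj: "inj f" using f by (rule permutes_inj)
  have img: "f ` {1..n} = {1..n}" using f by (rule permutes_image)
  have mem: "f ` F \<in> window_family n k (f ` Y) \<longleftrightarrow> F \<in> window_family n k Y" for F
  proof -
    have "f ` F \<subseteq> {1..n} \<longleftrightarrow> F \<subseteq> {1..n}" using inj img by (metis inj_image_subset_iff)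
    moreover have "card (f ` F \<inter> f ` Y) = card (F \<inter> Y)"
      using inj by (metis card_image image_Int inj_on_subset subset_UNIV)
    moreover have "card (f ` Y) = card Y" using inj by (metis card_image inj_on_subset subset_UNIV)
    ultimately show ?thesis by (simp add: window_family_def)
  qed
  show ?thesis
  proof (intro equalityI subsetI)
    fix G assume G: "G \<in> window_family n k (f ` Y)"
    have "surj f" using f by (rule permutes_surj)
    then have "G = f ` (f -` G)" by (simp add: surj_image_vimage_eq)
    then show "G \<in> image f ` window_family n k Y" using G mem by (metis imageI)
  qed (use mem in auto)
qed

lemma isomorphic_window_family:
  assumes "isomorphic_families n \<A> (window_family n k {1..T})" "T \<le> n"
  shows "\<exists>Y \<subseteq> {1..n}. card Y = T \<and> \<A> = window_family n k Y"
proof -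
  obtain f where f: "f permutes {1..n}" "\<A> = {f ` B |B. B \<in> window_family n k {1..T}}"
    using assms by (auto simp: isomorphic_families_def)
  then have "\<A> = window_family n k (f ` {1..T})"
    using image_window_family[OF f(1), of "{1..T}" k] by auto
  moreover have "f ` {1..T} \<subseteq> {1..n}"
    using permutes_image[OF f(1)] assms(2) by (metis atLeastatMost_subset_iff image_mono le_refl)
  moreover have "card (f ` {1..T}) = T"
    using permutes_inj[OF f(1)] by (metis card_atLeastAtMost card_image diff_Suc_1 inj_on_subset subset_UNIV)
  ultimately show ?thesis by blast
qed

lemma window_family_isomorphic:
  assumes "Y \<subseteq> {1..n}" "card Y = T" "T \<le> n"
  shows "isomorphic_families n (window_family n k Y) (window_family n k {1..T})"
proof -
  obtain f where "f permutes {1..n}" "f ` {1..T} = Y" using ex_permutes_image[OF assms] by blast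
  then show ?thesis
    using image_window_family[of f n "{1..T}" k] by (auto simp: isomorphic_families_def)
qed

lemma card_window_family_cong:
  assumes "Y \<subseteq> {1..n}" "Y' \<subseteq> {1..n}" "card Y = card Y'"
  shows "card (window_family n k Y) = card (window_family n k Y')"
proof -
  have "card (window_family n k Z) = card (window_family n k {1..card Z})" if Z: "Z \<subseteq> {1..n}" for Z
  proof -
    have "card Z \<le> n" using card_mono[OF _ Z] by simp
    then obtain f where f: "f permutes {1..n}" "f ` {1..card Z} = Z"
      using ex_permutes_image[OF Z refl \<open>card Z \<le> n\<close>] by blast
    have "inj_on (image f) (window_family n k {1..card Z})"
      using permutes_inj[OF f(1)] by (meson inj_image_eq_iff inj_onI)
    then show ?thesis using image_window_family[OF f(1), of "{1..card Z}" k] f(2)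
      by (metis card_image finite_atLeastAtMost)
  qed
  then show ?thesis using assms by metis
qed

lemma mu_window_family_cong:
  assumes "Y \<subseteq> {1..n}" "card Y = T"
  shows "mu n p (window_family n k Y) = mu n p (window_family n k {1..T})"
proof -
  have "T \<le> n" using card_mono[OF _ assms(1)] assms(2) by simp
  then obtain f where f: "f permutes {1..n}" "f ` {1..T} = Y"
    using ex_permutes_image[OF assms] by blast
  have inj: "inj f" using f(1) by (rule permutes_inj)
  then have "inj_on (image f) (window_family n k {1..T})"
    by (meson inj_image_eq_iff inj_onI)
  then have "mu n p (window_family n k Y) = (\<Sum>F\<in>window_family n k {1..T}. weight n p (f ` F))"
    using image_window_family[OF f(1), of "{1..T}" k] f(2) by (simp add: mu_def sum.reindex)
  also have "\<dots> = mu n p (window_family n k {1..T})"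
    using inj by (simp add: mu_def weight_def card_image inj_on_subset)
  finally show ?thesis .
qed

text \<open>A set meeting \<open>Y\<close> in fewer than \<open>t + k\<close> elements misses \<open>k + 1\<close> elements of \<open>Y\<close>,
  hence meets some \<open>(t + k)\<close>-subset of \<open>Y\<close> in fewer than \<open>t\<close> elements.\<close>

lemma window_family_eqI:
  assumes cr: "cross_intersecting t \<A> \<B>" and sub: "\<A> \<subseteq> Pow {1..n}"
    and Y: "Y \<subseteq> {1..n}" "card Y = t + 2 * k" and B: "\<And>Z. Z \<subseteq> Y \<Longrightarrow> card Z = t + k \<Longrightarrow> Z \<in> \<B>"
    and card: "card \<A> = card (window_family n k Y)" and "1 \<le> t"
  shows "\<A> = window_family n k Y"
proof (rule card_subset_eq[OF _ _ card])
  have fin: "finite Y" using Y finite_subset by auto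
  show "finite (window_family n k Y)"
    by (rule finite_family[of _ n]) (auto simp: window_family_def)
  show "\<A> \<subseteq> window_family n k Y"
  proof
    fix F assume F: "F \<in> \<A>"
    have "card Y \<le> card (F \<inter> Y) + k"
    proof (rule ccontr)
      assume small: "\<not> card Y \<le> card (F \<inter> Y) + k"
      have "card Y = card (F \<inter> Y) + card (Y - F)"
        using fin by (metis card_Diff_subset_Int card_mono finite_Int inf.commute inf_le2 le_add_diff_inverse)
      then have "k + 1 \<le> card (Y - F)" using small by simp
      then obtain M where M: "M \<subseteq> Y - F" "card M = k + 1" "finite M"
        using obtain_subset_with_card_n by metis
      have "card (Y - M) = t + k - 1"
        using M Y fin by (subst card_Diff_subset) auto
      then have "t - 1 \<le> card (Y - M)" by simp
      then obtain N where N: "N \<subseteq> Y - M" "card N = t - 1" "finite N"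
        using obtain_subset_with_card_n by metis
      have "card (M \<union> N) = t + k" using M N \<open>1 \<le> t\<close> by (subst card_Un_disjoint) auto
      moreover have "M \<union> N \<subseteq> Y" using M N by auto
      ultimately have "t \<le> card (F \<inter> (M \<union> N))" using B cr F by (auto simp: cross_intersecting_def)
      also have "\<dots> \<le> card N" using M N by (intro card_mono) auto
      finally show False using N \<open>1 \<le> t\<close> by simp
    qed
    then show "F \<in> window_family n k Y" using F sub by (auto simp: window_family_def)
  qed
qed

text \<open>Shifting preserves cardinalities, so each family contains a \<open>t\<close>-set. Cross
  \<open>t\<close>-intersection makes these two sets equal, and the common set is the
  window.\<close>

lemma unshift_window_0:
  assumes cr: "cross_intersecting t \<A> \<B>" and sub: "\<A> \<subseteq> Pow {1..n}" "\<B> \<subseteq> Pow {1..n}"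
    and Y: "Y \<subseteq> {1..n}" "card Y = t" and "1 \<le> t"
    and sA: "shift x y \<A> = window_family n 0 Y" and sB: "shift x y \<B> = window_family n 0 Y"
  shows "\<exists>Y' \<subseteq> {1..n}. card Y' = t \<and> \<A> = window_family n 0 Y' \<and> \<B> = window_family n 0 Y'"
proof -
  have fin: "finite Y" using Y finite_subset by auto
  have Ymem: "Y \<in> window_family n 0 Y" using Y by (simp add: window_family_def)
  have ex: "\<exists>Z\<in>\<C>. card Z = t" if "shift x y \<C> = window_family n 0 Y" for \<C>
    using shift_memD[of Y x y \<C>] Ymem that Y fin card_swap_elem[of Y x y] by auto
  obtain Z where Z: "Z \<in> \<A>" "card Z = t" using ex[OF sA] by auto
  obtain Z' where Z': "Z' \<in> \<B>" "card Z' = t" using ex[OF sB] by auto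
  have fZ: "finite Z" "finite Z'" using Z Z' \<open>1 \<le> t\<close> by (auto intro: card_ge_0_finite)
  have "t \<le> card (Z \<inter> Z')" using cr Z Z' by (auto simp: cross_intersecting_def)
  then have ZZ: "Z \<inter> Z' = Z" "Z \<inter> Z' = Z'"
    using Z Z' fZ by (metis card_seteq inf_le1, metis card_seteq inf_le2)
  have [simp]: "Z' = Z" by (rule trans[OF ZZ(2)[symmetric] ZZ(1)])
  have Zn: "Z \<subseteq> {1..n}" using Z sub by auto
  have uniq: "W = Z" if "W \<subseteq> Z" "card W = t + 0" for W
    using that Z fZ by (simp add: card_subset_eq)
  have "\<A> = window_family n 0 Z"
    using cr sub(1) Zn _ _ _ \<open>1 \<le> t\<close>
  proof (rule window_family_eqI)
    show "card \<A> = card (window_family n 0 Z)"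
      using card_shift[of x y \<A>] sA card_window_family_cong[OF Y(1) Zn] Y Z by simp
  qed (use Z Z' uniq in auto)
  moreover have "\<B> = window_family n 0 Z"
    using cross_intersecting_sym[OF cr] sub(2) Zn _ _ _ \<open>1 \<le> t\<close>
  proof (rule window_family_eqI)
    show "card \<B> = card (window_family n 0 Z)"
      using card_shift[of x y \<B>] sB card_window_family_cong[OF Y(1) Zn] Y Z by simp
  qed (use Z Z' uniq in auto)
  ultimately show ?thesis using Zn Z by blast
qed

text \<open>It suffices to find all sets \<open>Z - {z}\<close> of one window \<open>Z\<close> in
  both families. Only \<open>x \<in> Y\<close>, \<open>y \<notin> Y\<close> leaves a choice: every
  \<open>Y - {z}\<close> with z different from x then comes from itself or from
  \<open>Y' - {z}\<close>, where \<open>Y'\<close> has \<open>y\<close> in place of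
  \<open>x\<close>, and cross-intersection forces a consistent choice.\<close>

lemma unshift_window_1:
  assumes cr: "cross_intersecting t \<A> \<B>" and sub: "\<A> \<subseteq> Pow {1..n}" "\<B> \<subseteq> Pow {1..n}"
    and Y: "Y \<subseteq> {1..n}" "card Y = t + 2" and "2 \<le> t" and xy: "x \<in> {1..n}" "y \<in> {1..n}" "x \<noteq> y"
    and sA: "shift x y \<A> = window_family n 1 Y" and sB: "shift x y \<B> = window_family n 1 Y"
  shows "\<exists>Y' \<subseteq> {1..n}. card Y' = t + 2 \<and> \<A> = window_family n 1 Y' \<and> \<B> = window_family n 1 Y'"
proof -
  have fin: "finite Y" using Y finite_subset by auto
  have mem: "Y - {z} \<in> window_family n 1 Y" for z
  proof -
    have "(Y - {z}) \<inter> Y = Y - {z}" by auto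
    then show ?thesis using Y fin by (auto simp: window_family_def card_Diff_singleton_if)
  qed
  have concl: "\<exists>Y' \<subseteq> {1..n}. card Y' = t + 2 \<and> \<A> = window_family n 1 Y' \<and> \<B> = window_family n 1 Y'"
    if Z: "Z \<subseteq> {1..n}" "card Z = t + 2" and all: "\<And>z. z \<in> Z \<Longrightarrow> Z - {z} \<in> \<A> \<and> Z - {z} \<in> \<B>" for Z
  proof -
    have fZ: "finite Z" using Z finite_subset by auto
    have sets: "W \<in> \<A> \<and> W \<in> \<B>" if W: "W \<subseteq> Z" "card W = t + 1" for W
    proof -
      have "card (Z - W) = 1" using W Z fZ by (simp add: card_Diff_subset finite_subset)
      then obtain z where "Z - W = {z}" by (auto simp: card_1_singleton_iff)
      then have "z \<in> Z" "W = Z - {z}" using W by auto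
      then show ?thesis using all by auto
    qed
    have "\<A> = window_family n 1 Z"
      by (rule window_family_eqI[OF cr sub(1) Z(1)])
        (use Z sets \<open>2 \<le> t\<close> card_shift[of x y \<A>] sA card_window_family_cong[OF Y(1) Z(1)] Y in auto)
    moreover have "\<B> = window_family n 1 Z"
      by (rule window_family_eqI[OF cross_intersecting_sym[OF cr] sub(2) Z(1)])
        (use Z sets \<open>2 \<le> t\<close> card_shift[of x y \<B>] sB card_window_family_cong[OF Y(1) Z(1)] Y in auto)
    ultimately show ?thesis using Z by blast
  qed
  show ?thesis
  proof (cases "x \<in> Y \<and> y \<notin> Y")
    case False
    have all: "Y - {z} \<in> \<C>" if "z \<in> Y" "shift x y \<C> = window_family n 1 Y" for z \<C>
    proof (rule ccontr)
      assume n: "Y - {z} \<notin> \<C>"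
      then have 1: "x \<in> Y - {z}" "y \<notin> Y - {z}"
        using shift_memD[of "Y - {z}" x y \<C>] mem that by auto
      then have [simp]: "z = y" using False by auto
      \<comment> \<open>\<open>Y - {x}\<close> contains \<open>y\<close> but not \<open>x\<close>
        and lies in the shifted family, so its swap \<open>Y - {y}\<close> was present before the
        shift.\<close>
      have "y \<in> Y - {x}" using that xy by auto
      then have "swap_elem x y (Y - {x}) \<in> \<C>"
        using shift_memD2[of "Y - {x}" x y \<C>] mem that by auto
      moreover have "swap_elem x y (Y - {x}) = Y - {z}" using 1 xy by (auto simp: swap_elem_def)
      ultimately show False using n by simp
    qed
    show ?thesis using concl[OF Y] all sA sB by blast
  next
    case xY: True
    define Y' where "Y' = swap_elem y x Y"
    have Y': "Y' \<subseteq> {1..n}" "card Y' = t + 2"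
      using xY Y xy fin card_swap_elem[of Y x y] by (auto simp: Y'_def swap_elem_def)
    have sw: "swap_elem y x (Y - {z}) = Y' - {z}" if "z \<in> Y - {x}" for z
      using that xY by (auto simp: Y'_def swap_elem_def)
    have either: "Y - {z} \<in> \<C> \<or> Y' - {z} \<in> \<C>"
      if "z \<in> Y - {x}" "shift x y \<C> = window_family n 1 Y" for z \<C>
      using shift_memD[of "Y - {z}" x y \<C>] mem[of z] that sw by auto
    have yx: "Y' - {y} = Y - {x}" using xY by (auto simp: Y'_def swap_elem_def)
    have base: "Y - {x} \<in> \<C>" if "shift x y \<C> = window_family n 1 Y" for \<C>
      using shift_memD[of "Y - {x}" x y \<C>] mem[of x] that by auto
    \<comment> \<open>Three distinct elements are lost from the \<open>t + 2\<close> elements of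
      \<open>Y\<close>, which leaves t - 1.\<close>
    have clash: "False"
      if "Y - {z} \<in> \<C>" "Y' - {z'} \<in> \<D>" "cross_intersecting t \<C> \<D>" "z \<in> Y - {x}" "z' \<in> Y - {x}" "z \<noteq> z'"
      for z z' \<C> \<D>
    proof -
      have "(Y - {z}) \<inter> (Y' - {z'}) = Y - {x, z, z'}"
        using xY by (auto simp: Y'_def swap_elem_def)
      moreover have "card (Y - {x, z, z'}) = t - 1"
        using that Y fin xY by (subst card_Diff_subset) auto
      moreover have "t \<le> card ((Y - {z}) \<inter> (Y' - {z'}))"
        using that by (auto simp: cross_intersecting_def)
      ultimately show False using \<open>2 \<le> t\<close> by simp
    qed
    note crs = cr cross_intersecting_sym[OF cr]
    have step: "Y - {w} \<in> \<D>"
      if "cross_intersecting t \<C> \<D>" "shift x y \<D> = window_family n 1 Y"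
        "Y - {z} \<in> \<C>" "z \<in> Y - {x}" "w \<in> Y - {x}" "w \<noteq> z" for \<C> \<D> z w
      using either[of w \<D>] clash[of z \<C> w \<D>] that by blast
    have third: "\<exists>w. w \<in> Y - {x} \<and> w \<noteq> z \<and> w \<noteq> z'" for z z'
    proof -
      have "card {x, z, z'} < card Y" using Y \<open>2 \<le> t\<close> by (simp add: card_insert_if)
      then have "\<not> Y \<subseteq> {x, z, z'}" using card_mono[of "{x, z, z'}" Y] by auto
      then show ?thesis by auto
    qed
    \<comment> \<open>\<open>clash\<close> compares distinct indices only, so passing from
      \<open>z\<close> to another index within one family goes through the other family at a third
      index. This is possible because \<open>Y\<close> has at least four elements.\<close>
    have spread: "\<forall>w\<in>Y - {x}. Y - {w} \<in> \<C> \<and> Y - {w} \<in> \<D>"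
      if c: "cross_intersecting t \<C> \<D>" and sC: "shift x y \<C> = window_family n 1 Y"
        and sD: "shift x y \<D> = window_family n 1 Y"
        and z: "Y - {z} \<in> \<C>" "z \<in> Y - {x}" for \<C> \<D> z
    proof
      fix w assume w: "w \<in> Y - {x}"
      note c' = cross_intersecting_sym[OF c]
      have C: "Y - {w'} \<in> \<C>" if w': "w' \<in> Y - {x}" for w'
      proof -
        obtain v where v: "v \<in> Y - {x}" "v \<noteq> z" "v \<noteq> w'" using third by blast
        have "Y - {v} \<in> \<D>" using step[OF c sD z v(1,2)] .
        then show ?thesis using step[OF c' sC _ v(1) w'] v by auto
      qed
      obtain v where v: "v \<in> Y - {x}" "v \<noteq> w" using third by blast
      have "Y - {w} \<in> \<D>" using step[OF c sD C[OF v(1)] v(1) w] v by auto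
      then show "Y - {w} \<in> \<C> \<and> Y - {w} \<in> \<D>" using C[OF w] by simp
    qed
    show ?thesis
    proof (cases "\<exists>z\<in>Y - {x}. Y - {z} \<in> \<A> \<or> Y - {z} \<in> \<B>")
      case True
      then have "\<forall>w\<in>Y - {x}. Y - {w} \<in> \<A> \<and> Y - {w} \<in> \<B>"
        using spread[OF crs(1) sA sB] spread[OF crs(2) sB sA] by blast
      then show ?thesis using concl[OF Y] base[OF sA] base[OF sB] by blast
    next
      case False
      then have "Y' - {z} \<in> \<A> \<and> Y' - {z} \<in> \<B>" if "z \<in> Y - {x}" for z
        using either[OF that sA] either[OF that sB] that by blast
      moreover have "Y' - {y} \<in> \<A> \<and> Y' - {y} \<in> \<B>" using base[OF sA] base[OF sB] yx by simp
      moreover have "Y' = insert y (Y - {x})" by (simp add: Y'_def swap_elem_def)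
      ultimately show ?thesis using concl[OF Y'] by blast
    qed
  qed
qed

subsection \<open>Walks of shifted families\<close>

text \<open>In terms of prefix counts: together they reach l + t at some time l. The later analysis
  of walks uses this property in place of cross-intersection.\<close>

definition meeting :: "nat \<Rightarrow> nat \<Rightarrow> nat set set \<Rightarrow> nat set set \<Rightarrow> bool" where
  "meeting t n \<A> \<B> \<longleftrightarrow> (\<forall>F\<in>\<A>. \<forall>G\<in>\<B>. \<exists>l\<le>n. 2 * int t \<le> height F l + height G l)"

lemma meeting_sym: "meeting t n \<A> \<B> \<Longrightarrow> meeting t n \<B> \<A>"
  unfolding meeting_def by (metis add.commute)

text \<open>If the walks of \<open>F\<close> and \<open>G\<close> stay below the barrier, then some \<open>x < l\<close> lies
  outside \<open>F \<union> G\<close>, where \<open>l\<close> is the \<open>t\<close>-th element of \<open>F \<inter> G\<close>. Replacing \<open>l\<close> by \<open>x\<close> in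
  \<open>F\<close> keeps the walks below the barrier and makes the intersection smaller.\<close>

lemma shifted_imp_meeting:
  assumes sh: "shifted n \<A>" and cr: "cross_intersecting t \<A> \<B>"
    and sub: "\<A> \<subseteq> Pow {1..n}" "\<B> \<subseteq> Pow {1..n}"
  shows "meeting t n \<A> \<B>"
proof -
  have low: False
    if "F \<in> \<A>" "G \<in> \<B>" "\<forall>l\<le>n. card (F \<inter> {1..l}) + card (G \<inter> {1..l}) < l + t" for F G
    using that
  proof (induction "card (F \<inter> G)" arbitrary: F rule: less_induct)
    case less
    have FG: "F \<subseteq> {1..n}" "G \<subseteq> {1..n}" using less.prems sub by auto
    have fin: "finite F" "finite G" using FG finite_subset by auto
    let ?c = "\<lambda>m. card (F \<inter> G \<inter> {1..m})"
    have "F \<inter> G \<inter> {1..n} = F \<inter> G" using FG by auto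
    moreover have "t \<le> card (F \<inter> G)" using cr less.prems by (auto simp: cross_intersecting_def)
    ultimately have ex: "t \<le> ?c n" by simp
    define l where "l = (LEAST m. t \<le> ?c m)"
    have l: "t \<le> ?c l" unfolding l_def using ex by (rule LeastI)
    have "l \<le> n" unfolding l_def using ex by (rule Least_le)
    have min: "?c m < t" if "m < l" for m
      using not_less_Least[of m "\<lambda>m. t \<le> ?c m"] that unfolding l_def by simp
    have "t > 0" using less.prems(3)[rule_format, of 0] by simp
    then have "l \<noteq> 0" using l by (intro notI) simp
    then obtain k where k: "l = Suc k" by (cases l) auto
    have lin: "l \<in> F \<inter> G"
    proof (rule ccontr)
      assume "l \<notin> F \<inter> G"
      then have "F \<inter> G \<inter> {1..l} = F \<inter> G \<inter> {1..k}" using k by (auto simp: le_Suc_eq)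
      then show False using min[of k] l k by simp
    qed
    have union_inter: "card (H \<inter> {1..m}) + card (G \<inter> {1..m}) = card ((H \<union> G) \<inter> {1..m}) + card (H \<inter> G \<inter> {1..m})" for H m
    proof -
      have "H \<inter> {1..m} \<union> G \<inter> {1..m} = (H \<union> G) \<inter> {1..m}" "H \<inter> {1..m} \<inter> (G \<inter> {1..m}) = H \<inter> G \<inter> {1..m}"
        by blast+
      then show ?thesis using card_Un_Int[of "H \<inter> {1..m}" "G \<inter> {1..m}"] by simp
    qed
    have "card ((F \<union> G) \<inter> {1..l}) < l"
      using less.prems(3) \<open>l \<le> n\<close> l union_inter[of F l] by fastforce
    then have "(F \<union> G) \<inter> {1..l} \<noteq> {1..l}" by auto
    then obtain x where x: "x \<in> {1..l}" "x \<notin> F" "x \<notin> G" by blast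
    have "x < l" using x lin by (cases "x = l") auto
    define F' where "F' = swap_elem x l F"
    have F': "F' \<in> \<A>"
      using sh x \<open>x < l\<close> \<open>l \<le> n\<close> less.prems(1) lin by (auto simp: shifted_def F'_def)
    have inter: "F' \<inter> G = F \<inter> G - {l}" using x by (auto simp: F'_def swap_elem_def)
    then have "card (F' \<inter> G) < card (F \<inter> G)"
      using lin fin by (metis card_Diff1_less finite_Int)
    moreover have "\<forall>m\<le>n. card (F' \<inter> {1..m}) + card (G \<inter> {1..m}) < m + t"
    proof (intro allI impI)
      fix m assume "m \<le> n"
      show "card (F' \<inter> {1..m}) + card (G \<inter> {1..m}) < m + t"
      \<comment> \<open>Before \<open>l\<close> the barrier holds because the union has at most
        \<open>m\<close> and the intersection fewer than \<open>t\<close> elements; from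
        \<open>l\<close> on the prefix counts are unchanged.\<close>
      proof (cases "m < l")
        case True
        have "card (F' \<inter> {1..m}) + card (G \<inter> {1..m}) = card ((F' \<union> G) \<inter> {1..m}) + card (F' \<inter> G \<inter> {1..m})"
          by (rule union_inter)
        moreover have "card ((F' \<union> G) \<inter> {1..m}) \<le> card {1..m}" by (intro card_mono) auto
        moreover have "card (F' \<inter> G \<inter> {1..m}) \<le> ?c m" using inter by (intro card_mono) auto
        ultimately show ?thesis using min[OF True] by simp
      next
        case False
        then have "F' \<inter> {1..m} = swap_elem x l (F \<inter> {1..m})"
          using x by (auto simp: F'_def swap_elem_def)
        then have "card (F' \<inter> {1..m}) = card (F \<inter> {1..m})"
          using card_swap_elem[of "F \<inter> {1..m}" l x] x lin False \<open>l \<noteq> 0\<close> by simp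
        then show ?thesis using less.prems(3) \<open>m \<le> n\<close> by simp
      qed
    qed
    ultimately show False using less.hyps F' less.prems(2) by blast
  qed
  show ?thesis
    unfolding meeting_def
  proof (intro ballI, rule ccontr)
    fix F G assume FG: "F \<in> \<A>" "G \<in> \<B>" and "\<not> (\<exists>l\<le>n. 2 * int t \<le> height F l + height G l)"
    then have "\<forall>l\<le>n. card (F \<inter> {1..l}) + card (G \<inter> {1..l}) < l + t"
      by (force simp: height_def)
    then show False using low FG by blast
  qed
qed

section \<open>Maximal heights and the common time\<close>

lemma reaching_0: "reaching n 0 = Pow {1..n}"
  by (auto simp: reaching_def intro!: exI[of _ 0])

lemma reaching_mono: "u \<le> v \<Longrightarrow> reaching n v \<subseteq> reaching n u"
  by (auto simp: reaching_def)

lemma height_le: "height F l \<le> int l"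
proof -
  have "card (F \<inter> {1..l}) \<le> card {1..l}" by (intro card_mono) auto
  then show ?thesis by (simp add: height_def)
qed

lemma reaching_extremal:
  assumes "\<A> \<subseteq> reaching n u0" "\<A> \<noteq> {}"
  obtains u where "u0 \<le> u" "\<A> \<subseteq> reaching n u" "\<exists>F\<in>\<A>. F \<notin> reaching n (Suc u)"
proof -
  let ?P = "\<lambda>u. \<exists>F\<in>\<A>. F \<notin> reaching n (Suc u)"
  have "F \<notin> reaching n (Suc n)" for F
    using height_le[of F] by (auto simp: reaching_def) (smt (verit) of_nat_mono)
  then have ex: "?P n" using assms by auto
  define u where "u = (LEAST u. ?P u)"
  have "?P u" unfolding u_def using ex by (rule LeastI)
  have below: "\<A> \<subseteq> reaching n (Suc w)" if "w < u" for w
    using not_less_Least[of w ?P] that unfolding u_def by auto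
  have "u0 \<le> u"
  proof (rule ccontr)
    assume "\<not> u0 \<le> u"
    then have "reaching n u0 \<subseteq> reaching n (Suc u)" by (intro reaching_mono) simp
    then show False using \<open>?P u\<close> assms by blast
  qed
  moreover have "\<A> \<subseteq> reaching n u"
  proof (cases "u = u0")
    case False
    then have "u - 1 < u" "Suc (u - 1) = u" using \<open>u0 \<le> u\<close> by auto
    then show ?thesis using below[of "u - 1"] by simp
  qed (use assms in simp)
  ultimately show ?thesis using that \<open>?P u\<close> by blast
qed

lemma card_prefix_le: "card (F \<inter> {1..l}) \<le> l"
  using card_mono[of "{1..l}" "F \<inter> {1..l}"] by simp

lemma card_prefix_mono:
  assumes "l \<le> m"
  shows "card (F \<inter> {1..l}) \<le> card (F \<inter> {1..m})" "card (F \<inter> {1..m}) \<le> card (F \<inter> {1..l}) + (m - l)"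
proof -
  show "card (F \<inter> {1..l}) \<le> card (F \<inter> {1..m})" using assms by (intro card_mono) auto
  have "F \<inter> {1..m} \<subseteq> (F \<inter> {1..l}) \<union> {Suc l..m}" by auto
  then have "card (F \<inter> {1..m}) \<le> card ((F \<inter> {1..l}) \<union> {Suc l..m})" by (intro card_mono) auto
  also have "\<dots> \<le> card (F \<inter> {1..l}) + card {Suc l..m}" by (rule card_Un_le)
  finally show "card (F \<inter> {1..m}) \<le> card (F \<inter> {1..l}) + (m - l)" by simp
qed

lemma not_reachingD: "F \<notin> reaching n (Suc u) \<Longrightarrow> F \<subseteq> {1..n} \<Longrightarrow> l \<le> n \<Longrightarrow> height F l \<le> int u"
  by (force simp: reaching_def)

lemma meeting_levels:
  assumes "meeting t n \<A> \<B>" "F \<in> \<A>" "G \<in> \<B>" "F \<subseteq> {1..n}" "G \<subseteq> {1..n}"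
    "F \<notin> reaching n (Suc u)" "G \<notin> reaching n (Suc v)"
  shows "2 * t \<le> u + v"
proof -
  obtain l where "l \<le> n" "2 * int t \<le> height F l + height G l"
    using assms(1-3) unfolding meeting_def by blast
  then show ?thesis using not_reachingD[OF assms(6,4)] not_reachingD[OF assms(7,5)] by fastforce
qed

text \<open>Since u + v = 2 * t, two walks that do not exceed their bounds can meet only where both
  attain them. \<open>F0\<close> and \<open>G0\<close> attain theirs at a single time T, and every
  other walk is compared with one of them, so it attains its bound at this T. \<open>i\<close> and
  \<open>j\<close> count the down steps of \<open>F0\<close> and \<open>G0\<close> up to T.\<close>

lemma meeting_window:
  assumes m: "meeting t n \<A> \<B>" and sub: "\<A> \<subseteq> Pow {1..n}" "\<B> \<subseteq> Pow {1..n}" and uv: "u + v = 2 * t"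
    and F0: "F0 \<in> \<A>" "F0 \<notin> reaching n (Suc u)"
      "\<not> (\<exists>k l. k < l \<and> l \<le> n \<and> int u \<le> height F0 k \<and> int u \<le> height F0 l)"
    and G0: "G0 \<in> \<B>" "G0 \<notin> reaching n (Suc v)"
      "\<not> (\<exists>k l. k < l \<and> l \<le> n \<and> int v \<le> height G0 k \<and> int v \<le> height G0 l)"
  obtains i j where "t + i + j \<le> n" "u + i = t + j" "v + j = t + i"
    "\<And>F. F \<in> \<A> \<Longrightarrow> F \<notin> reaching n (Suc u) \<Longrightarrow> card (F \<inter> {1..t + i + j}) = t + j"
    "\<And>G. G \<in> \<B> \<Longrightarrow> G \<notin> reaching n (Suc v) \<Longrightarrow> card (G \<inter> {1..t + i + j}) = t + i"
proof -
  have common: "\<exists>l\<le>n. height F l = int u \<and> height G l = int v"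
    if FG: "F \<in> \<A>" "F \<notin> reaching n (Suc u)" "G \<in> \<B>" "G \<notin> reaching n (Suc v)" for F G
  proof -
    obtain l where l: "l \<le> n" "2 * int t \<le> height F l + height G l"
      using m FG(1,3) unfolding meeting_def by blast
    have "height F l \<le> int u" "height G l \<le> int v"
      using not_reachingD[of F n u l] not_reachingD[of G n v l] FG sub l by auto
    then have "height F l = int u \<and> height G l = int v" using l uv by linarith
    then show ?thesis using l by blast
  qed
  obtain T where T: "T \<le> n" "height F0 T = int u" "height G0 T = int v"
    using common F0 G0 by blast
  have FT: "height F T = int u" if F: "F \<in> \<A>" "F \<notin> reaching n (Suc u)" for F
  proof -
    obtain l where l: "l \<le> n" "height F l = int u" "height G0 l = int v"
      using common[OF F G0(1,2)] by blast
    then have "l = T" using G0(3) T by (metis linorder_neqE_nat order_refl)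
    then show ?thesis using l by simp
  qed
  have GT: "height G T = int v" if G: "G \<in> \<B>" "G \<notin> reaching n (Suc v)" for G
  proof -
    obtain l where l: "l \<le> n" "height F0 l = int u" "height G l = int v"
      using common[OF F0(1,2) G] by blast
    then have "l = T" using F0(3) T by (metis linorder_neqE_nat order_refl)
    then show ?thesis using l by simp
  qed
  define i where "i = T - card (F0 \<inter> {1..T})"
  define j where "j = T - card (G0 \<inter> {1..T})"
  have 1: "card (F0 \<inter> {1..T}) + i = T" "card (G0 \<inter> {1..T}) + j = T"
    unfolding i_def j_def using card_prefix_le by simp_all
  have 2: "2 * card (F0 \<inter> {1..T}) = u + T" "2 * card (G0 \<inter> {1..T}) = v + T"
    using T by (simp_all add: height_def)
  have 3: "T = t + i + j" "u + i = t + j" "v + j = t + i" using 1 2 uv by linarith+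
  show ?thesis
  proof (rule that[of i j])
    show "t + i + j \<le> n" using T 3 by simp
    show "u + i = t + j" "v + j = t + i" by fact+
    show "card (F \<inter> {1..t + i + j}) = t + j" if "F \<in> \<A>" "F \<notin> reaching n (Suc u)" for F
      using FT[OF that] 3 by (simp add: height_def)
    show "card (G \<inter> {1..t + i + j}) = t + i" if "G \<in> \<B>" "G \<notin> reaching n (Suc v)" for G
      using GT[OF that] 3 by (simp add: height_def)
  qed
qed

text \<open>Complement of the hitting event of \<open>reach_from\<close>. Starting two below the
  level makes the loss second order in p / (1 - p).\<close>

lemma avoid_from:
  assumes p: "0 < p" "p \<le> 1/2" and "W \<le> n" and C: "\<C> \<subseteq> Pow {1..W}"
    and h: "\<And>C. C \<in> \<C> \<Longrightarrow> height C W = c - 2"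
  shows "mu W p \<C> * (1 - (p / (1 - p)) ^ 2)
    \<le> mu n p {F. F \<subseteq> {1..n} \<and> F \<inter> {1..W} \<in> \<C> \<and> (\<forall>l\<in>{W..n}. height F l < c)}"
proof -
  define X where "X = {F. F \<subseteq> {1..n} \<and> F \<inter> {1..W} \<in> \<C> \<and> (\<forall>l\<in>{W..n}. height F l < c)}"
  define R where "R = {F. F \<subseteq> {1..n} \<and> F \<inter> {1..W} \<in> \<C> \<and> (\<exists>l\<in>{W..n}. c \<le> height F l)}"
  have fin: "finite R" "finite \<C>" using finite_family[of R n] finite_family[OF C] by (auto simp: R_def)
  have "mu n p R = (\<Sum>C\<in>\<C>. \<Sum>F | F \<in> R \<and> F \<inter> {1..W} = C. weight n p F)"
    unfolding mu_def using fin by (intro sum.group[symmetric]) (auto simp: R_def)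
  also have "\<dots> \<le> (\<Sum>C\<in>\<C>. weight W p C * (p / (1 - p)) ^ 2)"
  proof (rule sum_mono)
    fix C assume C': "C \<in> \<C>"
    then have "{F. F \<in> R \<and> F \<inter> {1..W} = C}
        = {F. F \<subseteq> {1..n} \<and> F \<inter> {1..W} = C \<and> (\<exists>l\<in>{W..n}. c \<le> height F l)}"
      by (auto simp: R_def)
    then show "(\<Sum>F | F \<in> R \<and> F \<inter> {1..W} = C. weight n p F) \<le> weight W p C * (p / (1 - p)) ^ 2"
      using reach_from[OF p refl \<open>W \<le> n\<close>, of C c] C C' h[OF C'] by (auto simp: mu_def)
  qed
  also have "\<dots> = mu W p \<C> * (p / (1 - p)) ^ 2" by (simp only: mu_def sum_distrib_right)
  finally have R: "mu n p R \<le> mu W p \<C> * (p / (1 - p)) ^ 2" .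
  have "{F. F \<subseteq> {1..n} \<and> F \<inter> {1..W} \<in> \<C>} = X \<union> R" by (auto simp: X_def R_def not_less)
  then have "mu W p \<C> = mu n p (X \<union> R)"
    using mu_cylinder[of p W n \<C>] p assms(3,4) by simp
  also have "\<dots> \<le> mu n p X + mu n p R"
    using p by (intro mu_union_le) (auto simp: X_def R_def)
  finally show ?thesis unfolding X_def[symmetric] using R by (simp add: right_diff_distrib)
qed

section \<open>Measures of windows, and walks excluded by a set outside its window\<close>

lemma mu_window_0:
  assumes "0 \<le> p" "p \<le> 1" "T \<le> n"
  shows "mu n p (window_family n 0 {1..T}) = p ^ T"
proof -
  have "F \<inter> {1..T} \<in> {{1..T}} \<longleftrightarrow> T \<le> card (F \<inter> {1..T})" for F
  proof
    assume "F \<inter> {1..T} \<in> {{1..T}}"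
    then have "F \<inter> {1..T} = {1..T}" by simp
    then show "T \<le> card (F \<inter> {1..T})" by (metis card_atLeastAtMost diff_Suc_1 order_refl)
  next
    assume "T \<le> card (F \<inter> {1..T})"
    then show "F \<inter> {1..T} \<in> {{1..T}}" using card_seteq[of "{1..T}" "F \<inter> {1..T}"] by simp
  qed
  then have "window_family n 0 {1..T} = {F. F \<subseteq> {1..n} \<and> F \<inter> {1..T} \<in> {{1..T}}}"
    by (simp add: window_family_def)
  then show ?thesis
    using mu_cylinder[OF assms, of "{{1..T}}"] by (simp add: mu_def weight_def)
qed

lemma mu_card_prefix:
  assumes "0 \<le> p" "p \<le> 1" "T \<le> n" "k \<le> T"
  shows "mu n p {F. F \<subseteq> {1..n} \<and> card (F \<inter> {1..T}) = k} = real (T choose k) * p ^ k * (1 - p) ^ (T - k)"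
proof -
  have "{F. F \<subseteq> {1..n} \<and> card (F \<inter> {1..T}) = k}
      = {F. F \<subseteq> {1..n} \<and> F \<inter> {1..T} \<in> {C. C \<subseteq> {1..T} \<and> card C = k}}" by auto
  then show ?thesis
    using mu_cylinder[OF assms(1-3), of "{C. C \<subseteq> {1..T} \<and> card C = k}"] mu_level[OF assms(4)] by auto
qed

lemma mu_window_1:
  assumes "0 \<le> p" "p \<le> 1" "T \<le> n" "1 \<le> T"
  shows "mu n p (window_family n 1 {1..T}) = p ^ T + real T * p ^ (T - 1) * (1 - p)"
proof -
  let ?X = "{F. F \<subseteq> {1..n} \<and> card (F \<inter> {1..T}) = T}"
  let ?Y = "{F. F \<subseteq> {1..n} \<and> card (F \<inter> {1..T}) = T - 1}"
  have "window_family n 1 {1..T} = ?X \<union> ?Y"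
  proof -
    have "T \<le> card (F \<inter> {1..T}) + 1 \<longleftrightarrow> card (F \<inter> {1..T}) = T \<or> card (F \<inter> {1..T}) = T - 1" for F
      using card_prefix_le[of F T] assms(4) by linarith
    then show ?thesis unfolding window_family_def by auto
  qed
  moreover have "?X \<inter> ?Y = {}" using assms(4) by auto
  moreover have "finite ?X" "finite ?Y" by (auto intro!: finite_family[of _ n])
  ultimately have "mu n p (window_family n 1 {1..T}) = mu n p ?X + mu n p ?Y"
    unfolding mu_def by (simp add: sum.union_disjoint)
  moreover have "T choose (T - 1) = T"
    using assms(4) binomial_symmetric[of 1 T] by simp
  ultimately show ?thesis
    using mu_card_prefix[OF assms(1-3), of T] mu_card_prefix[OF assms(1-3), of "T - 1"] assms(4) by simp
qed

text \<open>The price of a set \<open>F\<close> outside its window: the walks built here lie in the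
  window of \<B>, but never meet \<open>F\<close> and so are missing from \<B>. They omit
  \<open>j\<close> elements of {1..T}, go straight down for r + 2 steps and stay low afterwards,
  where \<open>F\<close> is bounded by u + r.\<close>

lemma excluded_part:
  assumes p: "0 < p" "p \<le> 1/2" and m: "meeting t n \<A> \<B>" and "1 \<le> t" "i \<le> 1"
    and T: "T = t + i + j" "T \<le> n" and uv: "u + i = t + j" "v + j = t + i"
    and F: "F \<in> \<A>" "F \<subseteq> {1..n}" "card (F \<inter> {1..T}) < t + j"
      "F \<in> reaching n (u + r)" "F \<notin> reaching n (Suc (u + r))" and "1 \<le> r"
  shows "\<exists>X \<subseteq> window_family n j {1..T}. X \<inter> \<B> = {} \<and>
    real ((t + j - 1) choose j) * (p ^ (t + i) * (1 - p) ^ (r + 2 + j)) * (1 - (p / (1 - p)) ^ 2) \<le> mu n p X"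
proof -
  \<comment> \<open>At T the walks have height v; r + 2 down steps bring them two below v - r, the
    level at which they could meet \<open>F\<close>.\<close>
  define W where "W = T + r + 2"
  let ?s = "t + j - 1"
  have cT: "card (F \<inter> {1..T}) \<le> ?s" using F(3) by simp
  have cl: "card (F \<inter> {1..l}) + i + 1 \<le> l" if "T \<le> l" for l
    using card_prefix_mono(2)[OF that, of F] that cT T \<open>1 \<le> t\<close> by linarith
  \<comment> \<open>From T on the set \<open>F\<close> lacks at least i + 1 elements, so height u +
    r takes time at least u + r + 2 (i + 1) = W. Before T that height is out of reach, since there
    it is at most t + j - 1 < u + r.\<close>
  have "W \<le> n"
  proof -
    obtain l where l: "l \<le> n" "int (u + r) \<le> height F l" using F(4) by (auto simp: reaching_def)
    have "T \<le> l"
    proof (rule ccontr)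
      assume "\<not> T \<le> l"
      then have "card (F \<inter> {1..l}) \<le> ?s" using card_prefix_mono(1)[of l T F] cT by simp
      moreover have "card (F \<inter> {1..l}) \<le> l" by (rule card_prefix_le)
      ultimately show False using l uv \<open>i \<le> 1\<close> \<open>1 \<le> r\<close> \<open>1 \<le> t\<close> by (simp add: height_def)
    qed
    then show ?thesis using cl[of l] l uv T by (simp add: height_def W_def)
  qed
  \<comment> \<open>All omissions lie among the first t + j - 1 times: at the end of that stretch
    the walk has t - 1 elements, while \<open>F\<close> may contain the whole stretch.\<close>
  let ?Ys = "{Y. Y \<subseteq> {1..?s} \<and> card Y = j}"
  define \<C> where "\<C> = (\<lambda>Y. {1..T} - Y) ` ?Ys"
  \<comment> \<open>These walks have height \<open>v - r - 2\<close> at time \<open>W\<close>, and up to \<open>W\<close> they miss the walk of \<open>F\<close> by one.\<close>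
  define X where "X = {G. G \<subseteq> {1..n} \<and> G \<inter> {1..W} \<in> \<C> \<and> (\<forall>l\<in>{W..n}. height G l < int v - int r)}"
  have sT: "?s \<le> T" using T by simp
  have YT: "Y \<subseteq> {1..T}" "finite Y" if "Y \<in> ?Ys" for Y
    using that sT finite_subset[of Y "{1..?s}"] by auto
  have inj: "inj_on (\<lambda>Y. {1..T} - Y) ?Ys"
  proof (rule inj_onI)
    fix Y Z assume "Y \<in> ?Ys" "Z \<in> ?Ys" "{1..T} - Y = {1..T} - Z"
    then show "Y = Z" using YT[of Y] YT[of Z] by (metis double_diff order_refl)
  qed
  have Csub: "\<C> \<subseteq> Pow {1..W}" by (auto simp: \<C>_def W_def)
  have cardC: "card C = t + i" if "C \<in> \<C>" for C
  proof -
    obtain Y where Y: "Y \<in> ?Ys" "C = {1..T} - Y" using \<open>C \<in> \<C>\<close> by (auto simp: \<C>_def)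
    then show ?thesis using YT[OF Y(1)] T by (simp add: card_Diff_subset)
  qed
  have "card \<C> = ?s choose j" unfolding \<C>_def using inj by (simp add: card_image n_subsets)
  moreover have "mu W p \<C> = (\<Sum>C\<in>\<C>. p ^ (t + i) * (1 - p) ^ (r + 2 + j))"
    unfolding mu_def by (rule sum.cong) (use T in \<open>simp_all add: weight_def cardC W_def add_ac\<close>)
  ultimately have mC: "mu W p \<C> = real (?s choose j) * (p ^ (t + i) * (1 - p) ^ (r + 2 + j))"
    by simp
  have "height C W = int v - int r - 2" if "C \<in> \<C>" for C
  proof -
    have "C \<inter> {1..W} = C" using that Csub by auto
    then show ?thesis using cardC[OF that] uv T by (simp add: height_def W_def)
  qed
  then have "real (?s choose j) * (p ^ (t + i) * (1 - p) ^ (r + 2 + j)) * (1 - (p / (1 - p)) ^ 2) \<le> mu n p X"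
    unfolding X_def mC[symmetric] using p \<open>W \<le> n\<close> Csub by (intro avoid_from) auto
  moreover have "X \<subseteq> window_family n j {1..T}"
  proof
    fix G assume G: "G \<in> X"
    have "(G \<inter> {1..W}) \<inter> {1..T} = G \<inter> {1..T}" by (auto simp: W_def)
    moreover have "(G \<inter> {1..W}) \<inter> {1..T} = G \<inter> {1..W}" using G by (auto simp: X_def \<C>_def)
    ultimately have "card (G \<inter> {1..T}) = t + i" using G cardC by (auto simp: X_def)
    then show "G \<in> window_family n j {1..T}" using G T by (auto simp: window_family_def X_def)
  qed
  moreover have "X \<inter> \<B> = {}"
  proof (rule ccontr)
    assume "X \<inter> \<B> \<noteq> {}"
    then obtain G where G: "G \<in> X" "G \<in> \<B>" by auto
    obtain Y where Y: "Y \<in> ?Ys" "G \<inter> {1..W} = {1..T} - Y" using G by (auto simp: X_def \<C>_def)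
    obtain l where l: "l \<le> n" "2 * int t \<le> height F l + height G l"
      using m F(1) G unfolding meeting_def by blast
    then have sum: "l + t \<le> card (F \<inter> {1..l}) + card (G \<inter> {1..l})" by (simp add: height_def)
    have GG: "G \<inter> {1..k} = ({1..T} - Y) \<inter> {1..k}" if "k \<le> W" for k
    proof -
      have "G \<inter> {1..k} = G \<inter> {1..W} \<inter> {1..k}" using that by auto
      then show ?thesis by (simp only: Y(2))
    qed
    have Gs: "card (G \<inter> {1..k}) = k - j" if "?s \<le> k" "k \<le> T" for k
    proof -
      have jY: "Y \<subseteq> {1..?s}" "card Y = j" "finite Y" using Y(1) YT(2)[OF Y(1)] by simp_all
      have "k \<le> W" using that by (simp add: W_def)
      then have "G \<inter> {1..k} = ({1..T} \<inter> {1..k}) - Y" by (simp only: GG) blast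
      moreover have "{1..T} \<inter> {1..k} = {1..k}" using that by auto
      ultimately have "G \<inter> {1..k} = {1..k} - Y" by (simp only:)
      moreover have "Y \<subseteq> {1..k}"
        by (rule subset_trans[OF jY(1)]) (use that(1) in simp)
      ultimately show ?thesis using jY(2,3) by (simp add: card_Diff_subset)
    qed
    \<comment> \<open>In the first three ranges the counts add up to at most l + t - 1: first
      \<open>G\<close> has at most t - 1 elements, then \<open>F\<close> at most t + j - 1 against l
      - j, then \<open>G\<close> rests at t + i while \<open>F\<close> lacks i + 1. In the last
      range the heights decide.\<close>
    consider "l \<le> ?s" | "?s \<le> l" "l \<le> T" | "T \<le> l" "l \<le> W" | "W \<le> l" by linarith
    then show False
    proof cases
      case 1
      then have "card (G \<inter> {1..l}) \<le> ?s - j" using card_prefix_mono(1)[OF 1, of G] Gs[OF order_refl sT] by simp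
      then show False using card_prefix_le[of F l] sum \<open>1 \<le> t\<close> by simp
    next
      case 2
      then have "card (F \<inter> {1..l}) \<le> ?s" using card_prefix_mono(1)[OF 2(2), of F] cT by simp
      then show False using Gs[OF 2] sum 2 T \<open>1 \<le> t\<close> by simp
    next
      case 3
      have "T \<le> W" by (simp add: W_def)
      moreover have "({1..T} - Y) \<inter> {1..l} = {1..T} - Y" using 3(1) by auto
      moreover have "({1..T} - Y) \<inter> {1..T} = {1..T} - Y" by blast
      ultimately have "G \<inter> {1..l} = G \<inter> {1..T}" using GG[OF 3(2)] GG[of T] by simp
      then have "card (G \<inter> {1..l}) = T - j" using Gs[OF sT order_refl] by simp
      then show False using cl[OF 3(1)] sum T by simp
    next
      case 4
      have "height F l \<le> int (u + r)" using not_reachingD[OF F(5,2) l(1)] .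
      moreover have "height G l < int v - int r" using G 4 l by (auto simp: X_def)
      ultimately show False using l uv by simp
    qed
  qed
  ultimately show ?thesis by blast
qed

subsection \<open>Estimates at the critical probability\<close>

text \<open>At t = 14, \<open>qt_squared\<close> needs an upper bound for e below sqrt (15 / 2) =
  2.738..., so the value 3 of \<open>exp_le\<close> is too weak.\<close>

lemma exp_1_le: "exp 1 \<le> (272 / 100 :: real)"
proof -
  obtain s :: real where s: "\<bar>s\<bar> \<le> \<bar>1\<bar>"
    "exp 1 = (\<Sum>m<7. 1 ^ m / fact m) + exp s / fact 7 * 1 ^ 7"
    using Maclaurin_exp_le[of 1 7] by blast
  have "exp s \<le> exp 1" using s(1) by simp
  then have "exp s \<le> 3" using exp_le by linarith
  moreover have "(\<Sum>m<7. 1 ^ m / fact m) = (1957 / 720 :: real)"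
    by (simp add: eval_nat_numeral fact_numeral)
  ultimately show ?thesis using s(2) by (simp add: fact_numeral)
qed

lemma choose_two_real: "real (n choose 2) = real n * (real n - 1) / 2"
  by (induction n) (simp_all add: numeral_2_eq_2 field_simps)

context
  fixes t :: nat and p q :: real
  assumes t: "14 \<le> t" and p: "p = 1 / (real t + 1)" and q: "q = 1 - p"
begin

lemma p_bounds: "0 < p" "p \<le> 1 / 15" "q = real t / (real t + 1)" "p / q = 1 / real t"
  "real t * p = q" "14 / 15 \<le> q" "q < 1" "q + p = 1"
proof -
  show q': "q = real t / (real t + 1)" by (simp add: q p field_simps)
  show "0 < p" "p \<le> 1 / 15" "p / q = 1 / real t" "real t * p = q" "14 / 15 \<le> q" "q < 1" "q + p = 1"
    using t unfolding q' p by (auto simp: field_simps)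
qed

lemma pq_pos: "0 < p" "0 < q" "0 \<le> p" "0 \<le> q" "p \<le> 1" "q \<le> 1"
  using p_bounds(1,2,6,7) by linarith+

lemma qt_ge: "100 / 272 \<le> q ^ t"
proof -
  have "(1 + 1 / real t) ^ t \<le> exp 1"
    using exp_ge_one_plus_x_over_n_power_n[of t 1] t by simp
  then have le: "(1 + 1 / real t) ^ t \<le> 272 / 100" using exp_1_le by linarith
  have "q * (1 + 1 / real t) = 1" using t p_bounds(3) by (simp add: field_simps)
  then have "q ^ t * (1 + 1 / real t) ^ t = 1" by (simp flip: power_mult_distrib)
  moreover have "q ^ t * (1 + 1 / real t) ^ t \<le> q ^ t * (272 / 100)"
    using le p_bounds by (intro mult_left_mono) auto
  ultimately show ?thesis by simp
qed

text \<open>\<open>(q ^ t)\<^sup>2\<close> is the quotient of p^(2t) and (1/t)^(2t). The first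
  inequality is the tight one: it compares 2/15 = 0.1333... with (100/272)^2 = 0.1351...\<close>

lemma qt_squared: "2 * p < (q ^ t)\<^sup>2" "1 / real t < (q ^ t)\<^sup>2"
proof -
  have "(100 / 272)\<^sup>2 \<le> (q ^ t)\<^sup>2" using qt_ge by (intro power_mono) auto
  moreover have "1 / real t \<le> 1 / 14" using t by (intro divide_left_mono) auto
  ultimately show "2 * p < (q ^ t)\<^sup>2" "1 / real t < (q ^ t)\<^sup>2"
    using p_bounds(2) by (simp_all add: power2_eq_square)
qed

text \<open>Times q^t this is the probability of \<open>b\<close> successes in t + a + b trials.
  Pascal's rule makes the value at (a, b) the mean of those at (a - 1, b) and (a, b - 1) with
  weights q and p, so only the edges need an estimate. Equality occurs at a = 0, b = 1.\<close>

lemma binomial_term_le_1: "real ((t + a + b) choose b) * p ^ b * q ^ a \<le> 1"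
proof (induction "a + b" arbitrary: a b rule: less_induct)
  case less
  show ?case
  proof (cases b)
    case 0
    then show ?thesis using p_bounds by (simp add: power_le_one)
  next
    case b: (Suc b')
    show ?thesis
    proof (cases a)
      case 0
      have "real (Suc b') * real ((t + Suc b') choose Suc b') = real (t + Suc b') * real ((t + b') choose b')"
        using Suc_times_binomial_eq[of "t + b'" b'] by (metis add_Suc_right mult.commute of_nat_mult)
      then have "real ((t + b) choose b) * p ^ b
          = real (t + Suc b') / (real (Suc b') * (real t + 1)) * (real ((t + b') choose b') * p ^ b')"
      proof -
        have "c * (p * K) = m / (k * s) * (c' * K)"
          if "k * c = m * c'" "0 < k" "p = 1 / s" "0 < s" for c c' k m s K :: real
          using that by (simp add: field_simps)
        then show ?thesis
          using p \<open>real (Suc b') * _ = _\<close> unfolding b power_Suc by (metis add_nonneg_pos of_nat_0_le_iff of_nat_0_less_iff zero_less_Suc zero_less_one)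
      qed
      \<comment> \<open>Consecutive values on the edge a = 0 have ratio (t + b) / (b (t + 1)), at
        most 1 for b \<ge> 1.\<close>
      also have "\<dots> \<le> 1 * 1"
      proof (intro mult_mono)
        show "real (t + Suc b') / (real (Suc b') * (real t + 1)) \<le> 1"
        proof (subst divide_le_eq_1_pos)
          show "0 < real (Suc b') * (real t + 1)" by (intro mult_pos_pos) auto
        qed (simp add: algebra_simps)
        show "real ((t + b') choose b') * p ^ b' \<le> 1" using less[of 0 b'] b 0 by simp
      qed (use p_bounds(1) in auto)
      finally show ?thesis using 0 by simp
    next
      case a: (Suc a')
      have "(t + a + b) choose b = ((t + a' + b) choose b) + ((t + a + b') choose b')"
        by (simp add: a b)
      then have "real ((t + a + b) choose b) * p ^ b * q ^ a
          = q * (real ((t + a' + b) choose b) * p ^ b * q ^ a')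
          + p * (real ((t + a + b') choose b') * p ^ b' * q ^ a)"
        by (simp add: a b algebra_simps)
      also have "\<dots> \<le> q * 1 + p * 1"
        using pq_pos less[of a' b] less[of a b'] a b by (intro add_mono mult_left_mono) auto
      finally show ?thesis using p_bounds by simp
    qed
  qed
qed

text \<open>The value grows in \<open>a\<close> up to the diagonal a = b, and along the diagonal it
  does not increase. Hence a = b = 2 decides, with 0.592... at t = 14.\<close>

lemma binomial_term_le_small:
  assumes "2 \<le> b" "a \<le> b"
  shows "real ((t + a + b) choose b) * p ^ b * q ^ a \<le> 6 / 10"
proof -
  have diag: "real ((t + b + b) choose b) * p ^ b * q ^ b \<le> 6 / 10"
    using assms(1)
  proof (induction b rule: dec_induct)
    case base
    have c: "real ((t + 4) choose 2) = (real t + 4) * (real t + 3) / 2"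
      using choose_two_real[of "t + 4"] by (simp add: algebra_simps)
    \<comment> \<open>In x = t - 14 the difference of the two sides has nonnegative
      coefficients.\<close>
    have "5 * ((real t + 4) * (real t + 3) * real t ^ 2) \<le> 6 * (real t + 1) ^ 4"
    proof -
      define x where "x = real t - 14"
      have "0 \<le> x" "real t = x + 14" using t x_def by auto
      then show ?thesis by (simp add: power2_eq_square power4_eq_xxxx algebra_simps)
    qed
    then have "(real t + 4) * (real t + 3) * real t ^ 2 / (2 * (real t + 1) ^ 4) \<le> 6 / 10"
      by (simp add: divide_le_eq)
    moreover have "t + 2 + 2 = t + 4" by simp
    moreover have "real ((t + 4) choose 2) * p ^ 2 * q ^ 2
        = (real t + 4) * (real t + 3) * real t ^ 2 / (2 * (real t + 1) ^ 4)"
      unfolding c p p_bounds(3) by (simp add: power_divide power_mult_distrib flip: power_add)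
    ultimately show ?case by metis
  next
    case (step b)
    define N where "N = t + b + b"
    have "real (Suc b) * real (Suc N choose Suc b) = real (Suc N) * real (N choose b)"
      by (metis Suc_times_binomial_eq mult.commute of_nat_mult)
    moreover have "real (t + b + 1) * real (Suc (Suc N) choose Suc b) = real (Suc (Suc N)) * real (Suc N choose Suc b)"
    proof -
      have "Suc (Suc N) - Suc b = t + b + 1" by (simp add: N_def)
      then show ?thesis
        using binomial_absorb_comp[of "Suc (Suc N)" "Suc b"] by (metis diff_Suc_1 mult.commute of_nat_mult)
    qed
    ultimately have rec: "real (t + b + 1) * real (Suc b) * real (Suc (Suc N) choose Suc b)
        = real (Suc (Suc N)) * real (Suc N) * real (N choose b)"
      by (metis (no_types, opaque_lifting) mult.assoc mult.left_commute)
    \<comment> \<open>The ratio of consecutive diagonal values is (N + 2) (N + 1) p q / ((t + b + 1)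
      (b + 1)); bounding N + 2 by twice t + b + 1 cancels a factor.\<close>
    have "(real N + 2) * (real N + 1) * real t \<le> (real t + real b + 1) * (real b + 1) * (real t + 1)\<^sup>2"
    proof -
      have "2 * (real N + 1) * real t \<le> (real b + 1) * (real t + 1)\<^sup>2"
      proof -
        obtain y where y: "b = y + 2" using step(1) by (metis add.commute le_Suc_ex)
        obtain z where z: "t = z + 14" using t by (metis add.commute le_Suc_ex)
        show ?thesis by (simp add: N_def y z power2_eq_square algebra_simps)
      qed
      then have "(real t + real b + 1) * (2 * (real N + 1) * real t)
          \<le> (real t + real b + 1) * ((real b + 1) * (real t + 1)\<^sup>2)"
        by (intro mult_left_mono) auto
      moreover have "(real N + 2) * ((real N + 1) * real t) \<le> (2 * (real t + real b + 1)) * ((real N + 1) * real t)"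
        by (intro mult_right_mono) (auto simp: N_def)
      moreover have "(2 * (real t + real b + 1)) * ((real N + 1) * real t) = (real t + real b + 1) * (2 * (real N + 1) * real t)"
        by (simp only: mult_ac)
      ultimately show ?thesis by (simp only: mult.assoc)
    qed
    then have "(real N + 2) * (real N + 1) * (p * q) \<le> (real t + real b + 1) * (real b + 1)"
    proof -
      have "p * q = real t / (real t + 1)\<^sup>2" by (simp add: p p_bounds(3) power2_eq_square)
      then have "(real N + 2) * (real N + 1) * (p * q) = (real N + 2) * (real N + 1) * real t / (real t + 1)\<^sup>2"
        by simp
      also have "\<dots> \<le> (real t + real b + 1) * (real b + 1)"
        using \<open>_ \<le> _ * (real t + 1)\<^sup>2\<close> by (subst pos_divide_le_eq) simp_all
      finally show ?thesis .
    qed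
    then have "(real N + 2) * (real N + 1) * (p * q) * (real (N choose b) * p ^ b * q ^ b)
        \<le> (real t + real b + 1) * (real b + 1) * (real (N choose b) * p ^ b * q ^ b)"
      using pq_pos by (intro mult_right_mono) auto
    also have "(real N + 2) * (real N + 1) * (p * q) * (real (N choose b) * p ^ b * q ^ b)
        = (real (Suc (Suc N)) * real (Suc N) * real (N choose b)) * (p ^ Suc b * q ^ Suc b)"
      by (simp add: ac_simps)
    also have "\<dots> = (real t + real b + 1) * (real b + 1) * (real (Suc (Suc N) choose Suc b) * p ^ Suc b * q ^ Suc b)"
      unfolding rec[symmetric] by (simp add: ac_simps del: binomial_Suc_Suc)
    finally have "real (Suc (Suc N) choose Suc b) * p ^ Suc b * q ^ Suc b \<le> real (N choose b) * p ^ b * q ^ b"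
      by (rule mult_left_le_imp_le) auto
    moreover have "t + Suc b + Suc b = Suc (Suc N)" by (simp add: N_def)
    ultimately show ?case using step.IH unfolding N_def by simp
  qed
  show ?thesis
    using assms(2)
  proof (induction a rule: inc_induct)
    case base
    then show ?case by (rule diag)
  next
    case (step a)
    define M where "M = t + a + b"
    have "real (Suc a + t) * real (Suc M choose b) = real (Suc M) * real (M choose b)"
    proof -
      have "Suc M - b = Suc a + t" by (simp add: M_def)
      then show ?thesis
        using binomial_absorb_comp[of "Suc M" b] by (metis diff_Suc_1 of_nat_mult)
    qed
    moreover have "real (Suc a + t) \<le> real (Suc M) * q"
    proof -
      have "(real (Suc a) + real t) * (real t + 1) \<le> (real t + real a + real b + 1) * real t"
      proof -
        obtain y where y: "b = a + Suc y" using step(2) by (metis add_Suc_right less_imp_Suc_add)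
        have "2 * real t \<le> real b * real t" using assms(1) by (intro mult_right_mono) auto
        moreover have "real b * 14 \<le> real b * real t" using t by (intro mult_left_mono) auto
        ultimately have "real t + real b \<le> real b * real t" using t by linarith
        then show ?thesis using y by (simp add: algebra_simps)
      qed
      then show ?thesis using t by (simp add: p_bounds(3) M_def field_simps)
    qed
    ultimately have "real (Suc a + t) * real (M choose b) \<le> real (Suc M) * q * real (M choose b)"
      "real (Suc M) * q * real (M choose b) = real (Suc a + t) * (real (Suc M choose b) * q)"
      by (auto intro: mult_right_mono)
    then have "real (M choose b) \<le> real (Suc M choose b) * q"
      by (metis mult_left_le_imp_le of_nat_0_less_iff add_Suc zero_less_Suc)
    then have "real (M choose b) * (p ^ b * q ^ a) \<le> real (Suc M choose b) * q * (p ^ b * q ^ a)"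
      using pq_pos by (intro mult_right_mono) auto
    then show ?case using step.IH by (simp add: M_def mult_ac)
  qed
qed

text \<open>\<open>x\<close> bounds what a family gains outside its window and \<open>c\<close> what
  the other must give up inside, both relative to the main term. Since 1/t \<le> q, the bound for
  \<open>x\<close> decays in \<open>r\<close> at least as fast as \<open>c\<close>, so r = 1 is the
  worst case: x \<le> 0.21 and c \<ge> 0.7, while x (2 + x) < 0.47 is what has to stay below
  c.\<close>

lemma excess_bound:
  assumes "1 \<le> r"
  defines "x \<equiv> (1 / real t) ^ r / q ^ (t + 1)"
  defines "c \<equiv> q ^ (r + 4) * (1 - (1 / real t)\<^sup>2)"
  shows "(1 + x) * (1 + x - c) < 1"
proof -
  have q0: "0 < q" using p_bounds by linarith
  define x1 where "x1 = (1 / real t) / q ^ (t + 1)"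
  have rS: "r = Suc (r - 1)" using assms by simp
  have "1 / real t \<le> 1 / 14" using t by (intro divide_left_mono) auto
  then have "1 / real t \<le> q" using p_bounds(6) by linarith
  then have "(1 / real t) ^ (r - 1) \<le> q ^ (r - 1)" by (intro power_mono) auto
  then have "x \<le> q ^ (r - 1) * x1"
    unfolding x_def x1_def using q0 t by (subst rS) (simp add: field_simps mult_left_mono)
  moreover have "x1 \<le> 21 / 100"
  proof -
    have "x1 = (1 / q ^ t) * ((real t + 1) / real t ^ 2)"
      using t by (simp add: x1_def p_bounds(3) power2_eq_square)
    also have "\<dots> \<le> (272 / 100) * (15 / 196)"
    proof (intro mult_mono)
      show "1 / q ^ t \<le> 272 / 100" using qt_ge by (simp add: field_simps)
      define y where "y = real t - 14"
      have "0 \<le> y" "real t = y + 14" using t y_def by auto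
      then have "(real t + 1) * 196 \<le> 15 * real t ^ 2" by (simp add: power2_eq_square algebra_simps)
      then show "(real t + 1) / real t ^ 2 \<le> 15 / 196" using t by (simp add: divide_le_eq)
    qed (use q0 in auto)
    finally show ?thesis by simp
  qed
  moreover have "q ^ (r - 1) * (7 / 10) \<le> c"
  proof -
    have "(14 / 15) ^ 5 \<le> q ^ 5" using p_bounds by (intro power_mono) auto
    moreover have "(1 / real t)\<^sup>2 \<le> (1 / 14)\<^sup>2" using t by (intro power_mono divide_left_mono) auto
    ultimately have "(14 / 15) ^ 5 * (1 - (1 / 14)\<^sup>2) \<le> q ^ 5 * (1 - (1 / real t)\<^sup>2)"
      using q0 by (intro mult_mono) (auto simp: power2_eq_square)
    then have "7 / 10 \<le> q ^ 5 * (1 - (1 / real t)\<^sup>2)" by (simp add: eval_nat_numeral)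
    then have "q ^ (r - 1) * (7 / 10) \<le> q ^ (r - 1) * (q ^ 5 * (1 - (1 / real t)\<^sup>2))"
      using q0 by (intro mult_left_mono) auto
    also have "\<dots> = q ^ (r - 1 + 5) * (1 - (1 / real t)\<^sup>2)" by (simp only: power_add mult.assoc)
    also have "r - 1 + 5 = r + 4" using assms by simp
    finally show ?thesis by (simp add: c_def)
  qed
  moreover have "0 < x" unfolding x_def using q0 t by simp
  moreover have q1: "0 < q ^ (r - 1)" "q ^ (r - 1) \<le> 1" using q0 p_bounds(7) by (simp_all add: power_le_one)
  ultimately have "x \<le> q ^ (r - 1) * (21 / 100)"
    by (smt (verit) mult_left_mono)
  moreover have "x \<le> 21 / 100" using calculation q1(2) by linarith
  ultimately have "x * (2 + x) \<le> q ^ (r - 1) * (21 / 100) * (2 + 21 / 100)"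
    using \<open>0 < x\<close> q1 by (intro mult_mono) auto
  also have "\<dots> < q ^ (r - 1) * (7 / 10)" using q1 by simp
  finally have "x * (2 + x) < c" using \<open>q ^ (r - 1) * (7 / 10) \<le> c\<close> by linarith
  then have "(1 + x) * (1 + x - c) < (1 + x) * (1 - x - x * x)"
    using \<open>0 < x\<close> by (intro mult_strict_left_mono) (auto simp: algebra_simps)
  also have "\<dots> \<le> 1" using \<open>0 < x\<close> by (simp add: algebra_simps)
  finally show ?thesis .
qed

subsection \<open>The walk argument\<close>

lemma power_ratio: "(1 / real t) ^ m * q ^ m = p ^ m"
proof -
  have "1 / real t * q = p" using t p_bounds(5) by (simp add: field_simps)
  then show ?thesis by (metis power_mult_distrib)
qed

lemma mu_reaching_critical: "mu n p (reaching n m) \<le> (1 / real t) ^ m"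
  using mu_reaching[of p n m] p_bounds(1,2,4) q by simp

text \<open>The tie occurs at size t + 2. A window of size t + 1 arises when exactly one of the two
  deficits is 1, and the strict part rules it out.\<close>

lemma mu_window_le:
  assumes "i \<le> 1" "T = u + 2 * i" "T \<le> n" "T \<le> t + 2"
  shows "mu n p (window_family n i {1..T}) \<le> p ^ u"
    and "i = 1 \<Longrightarrow> T < t + 2 \<Longrightarrow> mu n p (window_family n i {1..T}) < p ^ u"
proof -
  have one: "mu n p (window_family n 1 {1..T}) = p ^ u * (p\<^sup>2 + real T * p * q)" if "i = 1"
    using mu_window_1[of p T n, folded q] pq_pos assms that
    by (simp add: power2_eq_square algebra_simps)
  have crit: "p\<^sup>2 + (real t + 2) * p * q = 1"
  proof -
    have "p\<^sup>2 + (real t + 2) * p * q = p * p + (real t * p) * q + 2 * p * q"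
      by (simp add: power2_eq_square algebra_simps)
    also have "\<dots> = (p + q)\<^sup>2" unfolding p_bounds(5) by (simp add: power2_eq_square algebra_simps)
    finally show ?thesis using p_bounds(8) by (simp add: add.commute)
  qed
  show "mu n p (window_family n i {1..T}) \<le> p ^ u"
  proof (cases "i = 0")
    case True
    then show ?thesis using mu_window_0[of p T n] pq_pos assms by simp
  next
    case False
    then have i: "i = 1" using assms by simp
    have "real T * p * q \<le> (real t + 2) * p * q"
      using pq_pos assms by (intro mult_right_mono) auto
    then have "p\<^sup>2 + real T * p * q \<le> 1" using crit by linarith
    then have "p ^ u * (p\<^sup>2 + real T * p * q) \<le> p ^ u * 1"
      using pq_pos by (intro mult_left_mono) auto
    then show ?thesis using one i by simp
  qed
  assume i: "i = 1" and "T < t + 2"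
  then have "real T * p * q < (real t + 2) * p * q"
    using pq_pos by (intro mult_strict_right_mono) auto
  then have "p\<^sup>2 + real T * p * q < 1" using crit by linarith
  then have "p ^ u * (p\<^sup>2 + real T * p * q) < p ^ u * 1"
    using pq_pos by (intro mult_strict_left_mono) auto
  then show "mu n p (window_family n i {1..T}) < p ^ u" using one i by simp
qed

lemma height_step_le: "height F (Suc l) \<le> height F l + 1"
  using card_prefix_mono(2)[of l "Suc l" F] by (simp add: height_def)

text \<open>A walk exceeding \<open>u\<close> was at height at least \<open>u\<close> one step
  before, so it counts as a double visit as well.\<close>

lemma mu_le_if_twice:
  assumes "\<A> \<subseteq> Pow {1..n}"
    and "\<And>F. F \<in> \<A> \<Longrightarrow> F \<notin> reaching n (Suc u) \<Longrightarrow>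
      \<exists>k l. k < l \<and> l \<le> n \<and> int u \<le> height F k \<and> int u \<le> height F l"
  shows "mu n p \<A> \<le> 2 * p * (1 / real t) ^ u"
proof -
  let ?D = "{F. F \<subseteq> {1..n} \<and> (\<exists>k l. k < l \<and> l \<le> n \<and> int u \<le> height F k \<and> int u \<le> height F l)}"
  have "F \<in> ?D" if F: "F \<in> \<A>" for F
  proof (cases "F \<in> reaching n (Suc u)")
    case True
    then obtain l where l: "l \<le> n" "int (Suc u) \<le> height F l" by (auto simp: reaching_def)
    then have "l \<noteq> 0" by (intro notI) simp
    then obtain k where k: "l = Suc k" by (cases l) auto
    then have "int u \<le> height F k" "int u \<le> height F l" "k < l"
      using height_step_le[of F k] l by auto
    then show ?thesis using l F assms(1) by blast
  next
    case False
    then show ?thesis using assms F by blast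
  qed
  then have "mu n p \<A> \<le> mu n p ?D" using pq_pos by (intro mu_mono) auto
  also have "\<dots> \<le> 2 * p * (1 / real t) ^ u"
    using mu_reaching_twice[of p n u] p_bounds(1,2,4) q by simp
  finally show ?thesis .
qed

text \<open>Normalised by \<open>(p / q) ^ u\<close>, the mass of the sets with \<open>card (F \<inter> {1..T}) = T - i\<close> is a
  binomial point probability, so the product has a bound symmetric in \<open>i\<close> and \<open>j\<close>.\<close>

lemma mu_le_binomial:
  assumes "\<A> \<subseteq> Pow {1..n}" "t + i + j \<le> n" "u + i = t + j"
    and "\<And>F. F \<in> \<A> \<Longrightarrow> F \<notin> reaching n (Suc u) \<Longrightarrow> card (F \<inter> {1..t + i + j}) = t + j"
  shows "mu n p \<A> \<le> (1 / real t) ^ u *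
    (1 / real t + q ^ t * (real ((t + j + i) choose i) * p ^ i * q ^ j))"
proof -
  let ?L = "{F. F \<subseteq> {1..n} \<and> card (F \<inter> {1..t + i + j}) = t + j}"
  have "\<A> \<subseteq> reaching n (Suc u) \<union> ?L" using assms by blast
  then have "mu n p \<A> \<le> mu n p (reaching n (Suc u) \<union> ?L)"
    using pq_pos by (intro mu_mono) (auto simp: reaching_def)
  also have "\<dots> \<le> mu n p (reaching n (Suc u)) + mu n p ?L"
    using pq_pos by (intro mu_union_le) (auto simp: reaching_def)
  also have "mu n p ?L = real ((t + i + j) choose (t + j)) * p ^ (t + j) * q ^ i"
    using mu_card_prefix[of p "t + i + j" n "t + j"] pq_pos assms(2) q by simp
  also have "(t + i + j) choose (t + j) = (t + j + i) choose i"
    using binomial_symmetric[of i "t + j + i"] by (simp add: ac_simps)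
  also have "p ^ (t + j) = (1 / real t) ^ u * q ^ u * p ^ i"
    unfolding power_ratio assms(3)[symmetric] by (simp add: power_add)
  also have "real ((t + j + i) choose i) * ((1 / real t) ^ u * q ^ u * p ^ i) * q ^ i
      = (1 / real t) ^ u * (real ((t + j + i) choose i) * p ^ i * q ^ (u + i))"
    by (simp add: power_add)
  also have "q ^ (u + i) = q ^ t * q ^ j" unfolding assms(3) by (simp add: power_add)
  finally show ?thesis using mu_reaching_critical[of n "Suc u"] by (simp add: algebra_simps)
qed

text \<open>A deficit i \<ge> 2 improves one binomial factor to 6/10, the other is only bounded by
  1. Relative to q^t, the walks exceeding their bound add at most 2/10 to each, and (8/10) (12/10) <
  1.\<close>

lemma product_less_crude:
  assumes sub: "\<A> \<subseteq> Pow {1..n}" "\<B> \<subseteq> Pow {1..n}" and "t + i + j \<le> n"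
    and uv: "u + i = t + j" "v + j = t + i" and ij: "2 \<le> i" "j \<le> i"
    and F: "\<And>F. F \<in> \<A> \<Longrightarrow> F \<notin> reaching n (Suc u) \<Longrightarrow> card (F \<inter> {1..t + i + j}) = t + j"
    and G: "\<And>G. G \<in> \<B> \<Longrightarrow> G \<notin> reaching n (Suc v) \<Longrightarrow> card (G \<inter> {1..t + i + j}) = t + i"
  shows "mu n p \<A> * mu n p \<B> < p ^ (2 * t)"
proof -
  define a where "a = 1 / real t"
  define Q where "Q = q ^ t"
  have Q: "0 < Q" "100 / 272 \<le> Q" using pq_pos qt_ge by (auto simp: Q_def)
  have a: "0 < a" "a \<le> 1 / 14" using t by (auto simp: a_def intro: divide_left_mono)
  \<comment> \<open>This is 1/14 = 0.0714... against (2/10) (100/272) = 0.0735...\<close>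
  then have aQ: "a \<le> Q * (2 / 10)" using Q by linarith
  define f where "f = real ((t + j + i) choose i) * p ^ i * q ^ j"
  define g where "g = real ((t + i + j) choose j) * p ^ j * q ^ i"
  have f: "f \<le> 6 / 10" "0 \<le> f" unfolding f_def using binomial_term_le_small[OF ij] pq_pos by auto
  have g: "g \<le> 1" "0 \<le> g" unfolding g_def using binomial_term_le_1[of i j] pq_pos by auto
  have "mu n p \<A> \<le> a ^ u * (a + Q * f)"
    using mu_le_binomial[OF sub(1) assms(3) uv(1) F] by (simp add: a_def Q_def f_def)
  moreover have "mu n p \<B> \<le> a ^ v * (a + Q * g)"
    using mu_le_binomial[of \<B> n j i v] sub(2) assms(3) uv(2) G
    by (simp add: a_def Q_def g_def ac_simps)
  ultimately have "mu n p \<A> * mu n p \<B> \<le> (a ^ u * (a + Q * f)) * (a ^ v * (a + Q * g))"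
    using a f Q pq_pos by (intro mult_mono mu_nonneg) auto
  also have "\<dots> = a ^ (u + v) * ((a + Q * f) * (a + Q * g))" by (simp add: power_add)
  also have "u + v = 2 * t" using uv by linarith
  also have "(a + Q * f) * (a + Q * g) \<le> (Q * (8 / 10)) * (Q * (12 / 10))"
  proof (rule mult_mono)
    have "Q * f \<le> Q * (6 / 10)" "Q * g \<le> Q * 1" using f g Q by (auto intro: mult_left_mono)
    then show "a + Q * f \<le> Q * (8 / 10)" "a + Q * g \<le> Q * (12 / 10)" using aQ by auto
  qed (use a g Q in auto)
  also have "(Q * (8 / 10)) * (Q * (12 / 10)) < Q * Q" using Q by simp
  finally have "mu n p \<A> * mu n p \<B> < a ^ (2 * t) * (Q * Q)" using a by simp
  also have "\<dots> = p ^ (2 * t)"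
    using power_ratio[of "2 * t"] by (simp add: a_def Q_def mult_2 power_add)
  finally show ?thesis .
qed

text \<open>Outside their windows both families exceed their bounds by at least \<open>r\<close>,
  and \<open>F\<close> by exactly \<open>r\<close>. So \<A> has at most p^u (1 + x), and \<B>, which
  loses the walks excluded by \<open>F\<close>, at most p^v (1 + x - c).\<close>

lemma product_less_refined:
  assumes sub: "\<A> \<subseteq> Pow {1..n}" "\<B> \<subseteq> Pow {1..n}" and m: "meeting t n \<A> \<B>"
    and T: "T = t + i + j" "T \<le> n" and uv: "u + i = t + j" "v + j = t + i" and ij: "i \<le> 1" "j \<le> 1"
    and F: "F \<in> \<A>" "F \<notin> window_family n i {1..T}" "F \<notin> reaching n (Suc (u + r))" and "1 \<le> r"
    and rA: "\<A> - window_family n i {1..T} \<subseteq> reaching n (u + r)"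
    and rB: "\<B> - window_family n j {1..T} \<subseteq> reaching n (v + r)"
  shows "mu n p \<A> * mu n p \<B> < p ^ (2 * t)"
proof -
  define x where "x = (1 / real t) ^ r / q ^ (t + 1)"
  define c where "c = q ^ (r + 4) * (1 - (1 / real t)\<^sup>2)"
  have sq: "0 \<le> 1 - (1 / real t)\<^sup>2" using t by (simp add: power_le_one)
  have x: "0 \<le> x" using pq_pos by (simp add: x_def)
  have excess: "mu n p (reaching n (w + r)) \<le> p ^ w * x" if "w \<le> t + 1" for w
  proof -
    have "(1 / real t) ^ (w + r) * q ^ (t + 1) \<le> (1 / real t) ^ (w + r) * q ^ w"
      using pq_pos that by (intro mult_left_mono power_decreasing) auto
    also have "\<dots> = p ^ w * (1 / real t) ^ r" by (simp add: power_add power_ratio[symmetric])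
    finally have "(1 / real t) ^ (w + r) \<le> p ^ w * x"
      using pq_pos by (simp add: x_def pos_le_divide_eq)
    then show ?thesis using mu_reaching_critical[of n "w + r"] by linarith
  qed
  have uvt: "u \<le> t + 1" "v \<le> t + 1" "T \<le> t + 2" "T = u + 2 * i" "T = v + 2 * j"
    using uv ij T by linarith+
  have wsub: "window_family n k {1..T} \<subseteq> Pow {1..n}" for k by (auto simp: window_family_def)
  have rsub: "reaching n k \<subseteq> Pow {1..n}" for k by (auto simp: reaching_def)
  have Fn: "F \<subseteq> {1..n}" using F sub by auto
  have "card (F \<inter> {1..T}) < t + j" using F(2) Fn T by (auto simp: window_family_def)
  moreover have "F \<in> reaching n (u + r)" using F rA by blast
  moreover have "p \<le> 1 / 2" "1 \<le> t" using p_bounds(2) t by auto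
  ultimately obtain X where X: "X \<subseteq> window_family n j {1..T}" "X \<inter> \<B> = {}"
    "real ((t + j - 1) choose j) * (p ^ (t + i) * (1 - p) ^ (r + 2 + j)) * (1 - (p / (1 - p)) ^ 2) \<le> mu n p X"
    using excluded_part[OF p_bounds(1) _ m _ ij(1) T uv F(1) Fn _ _ F(3) \<open>1 \<le> r\<close>] by blast
  \<comment> \<open>One constant serves both values of \<open>j\<close>: for j = 0 by q^(r + 2)
    \<ge> q^(r + 4), for j = 1 because the t choices of the omitted element turn one p into
    q.\<close>
  have "p ^ v * c \<le> mu n p X"
  proof -
    have "p ^ v * q ^ (r + 4) \<le> real ((t + j - 1) choose j) * (p ^ (t + i) * q ^ (r + 2 + j))"
    proof (cases "j = 0")
      case True
      have "q ^ (r + 4) \<le> q ^ (r + 2)" using pq_pos by (intro power_decreasing) auto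
      then show ?thesis using True uv pq_pos by (simp add: mult_left_mono)
    next
      case False
      then have j: "j = 1" using ij by simp
      have "real t * (p ^ (t + i) * q ^ (r + 2 + j)) = p ^ v * ((real t * p) * q ^ (r + 3))"
        unfolding uv(2)[symmetric] j by (simp add: add.commute eval_nat_numeral)
      also have "\<dots> = p ^ v * q ^ (r + 4)" unfolding p_bounds(5) by (simp add: eval_nat_numeral)
      finally show ?thesis using j by simp
    qed
    then have "p ^ v * q ^ (r + 4) * (1 - (1 / real t)\<^sup>2)
        \<le> real ((t + j - 1) choose j) * (p ^ (t + i) * q ^ (r + 2 + j)) * (1 - (1 / real t)\<^sup>2)"
      using sq by (rule mult_right_mono)
    then show ?thesis using X(3) p_bounds(4) by (simp add: c_def q mult.assoc)
  qed
  have "mu n p \<A> \<le> mu n p (window_family n i {1..T} \<union> reaching n (u + r))"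
    using rA wsub rsub pq_pos by (intro mu_mono) auto
  also have "\<dots> \<le> mu n p (window_family n i {1..T}) + mu n p (reaching n (u + r))"
    using wsub rsub pq_pos by (intro mu_union_le) auto
  also have "\<dots> \<le> p ^ u + p ^ u * x"
    using mu_window_le(1)[OF ij(1) uvt(4) T(2) uvt(3)] excess[OF uvt(1)] by linarith
  finally have A: "mu n p \<A> \<le> p ^ u * (1 + x)" by (simp add: distrib_left)
  have "mu n p \<B> \<le> mu n p ((window_family n j {1..T} - X) \<union> reaching n (v + r))"
    using rB wsub[of j] rsub X(2) pq_pos by (intro mu_mono) auto
  also have "\<dots> \<le> mu n p (window_family n j {1..T} - X) + mu n p (reaching n (v + r))"
    using wsub rsub pq_pos by (intro mu_union_le) auto
  also have "mu n p (window_family n j {1..T} - X) = mu n p (window_family n j {1..T}) - mu n p X"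
    unfolding mu_def using X(1) finite_family[OF wsub] finite_subset by (intro sum_diff) auto
  finally have B: "mu n p \<B> \<le> p ^ v * (1 + x - c)"
    using mu_window_le(1)[OF ij(2) uvt(5) T(2) uvt(3)] excess[OF uvt(2)] \<open>p ^ v * c \<le> mu n p X\<close>
    by (simp add: algebra_simps)
  have "mu n p \<A> * mu n p \<B> \<le> (p ^ u * (1 + x)) * (p ^ v * (1 + x - c))"
    using A B x pq_pos by (intro mult_mono mu_nonneg) auto
  also have "\<dots> = p ^ (u + v) * ((1 + x) * (1 + x - c))" by (simp add: power_add)
  also have "\<dots> < p ^ (u + v) * 1"
    using excess_bound[OF \<open>1 \<le> r\<close>] pq_pos unfolding x_def c_def
    by (intro mult_strict_left_mono) auto
  also have "u + v = 2 * t" using uv by linarith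
  finally show ?thesis by simp
qed

end

context
  fixes t :: nat and p q :: real
  assumes t: "14 \<le> t" and p: "p = 1 / (real t + 1)" and q: "q = 1 - p"
begin

text \<open>If sets lie outside the windows, \<open>r\<close> is the smallest excess among them, and
  a family attaining it takes the role of \<A> in \<open>product_less_refined\<close>. Otherwise the
  windows themselves are compared with p^u and p^v.\<close>

lemma product_less_one_window:
  assumes sub: "\<A> \<subseteq> Pow {1..n}" "\<B> \<subseteq> Pow {1..n}" and m: "meeting t n \<A> \<B>"
    and T: "t + i + j \<le> n" and uv: "u + i = t + j" "v + j = t + i" and ij: "i \<le> 1" "j \<le> 1"
    and F: "\<And>F. F \<in> \<A> \<Longrightarrow> F \<notin> reaching n (Suc u) \<Longrightarrow> card (F \<inter> {1..t + i + j}) = t + j"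
    and G: "\<And>G. G \<in> \<B> \<Longrightarrow> G \<notin> reaching n (Suc v) \<Longrightarrow> card (G \<inter> {1..t + i + j}) = t + i"
  shows "mu n p \<A> * mu n p \<B> < p ^ (2 * t) \<or>
    i = j \<and> \<A> = window_family n i {1..t + 2 * i} \<and> \<B> = window_family n i {1..t + 2 * i}"
proof -
  define T where "T = t + i + j"
  define KA where "KA = window_family n i {1..T}"
  define KB where "KB = window_family n j {1..T}"
  have rA: "\<A> - KA \<subseteq> reaching n (Suc u)"
    using F sub by (auto simp: KA_def T_def window_family_def)
  have rB: "\<B> - KB \<subseteq> reaching n (Suc v)"
    using G sub by (auto simp: KB_def T_def window_family_def)
  have "p < 1" using p_bounds(2)[OF t p q] by simp
  note facts = pq_pos[OF t p q] this
  have K: "KA \<subseteq> Pow {1..n}" "KB \<subseteq> Pow {1..n}" by (auto simp: KA_def KB_def window_family_def)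
  have TT: "T = u + 2 * i" "T = v + 2 * j" "T \<le> n" "T \<le> t + 2" "u + v = 2 * t"
    using uv ij T by (auto simp: T_def)
  consider "\<A> \<subseteq> KA" "\<B> \<subseteq> KB"
    | r where "1 \<le> r" "\<exists>F\<in>\<A> - KA. F \<notin> reaching n (Suc (u + r))"
        "\<A> - KA \<subseteq> reaching n (u + r)" "\<B> - KB \<subseteq> reaching n (v + r)"
    | r where "1 \<le> r" "\<exists>G\<in>\<B> - KB. G \<notin> reaching n (Suc (v + r))"
        "\<A> - KA \<subseteq> reaching n (u + r)" "\<B> - KB \<subseteq> reaching n (v + r)"
  proof -
    have A: "\<exists>r\<ge>1. \<A> - KA \<subseteq> reaching n (u + r) \<and> (\<exists>F\<in>\<A> - KA. F \<notin> reaching n (Suc (u + r)))"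
      if "\<not> \<A> \<subseteq> KA"
    proof -
      from that have "\<A> - KA \<noteq> {}" by blast
      then obtain w where w: "Suc u \<le> w" "\<A> - KA \<subseteq> reaching n w" "\<exists>F\<in>\<A> - KA. F \<notin> reaching n (Suc w)"
        using reaching_extremal[OF rA] by metis
      then show ?thesis by (intro exI[of _ "w - u"]) auto
    qed
    have B: "\<exists>r\<ge>1. \<B> - KB \<subseteq> reaching n (v + r) \<and> (\<exists>G\<in>\<B> - KB. G \<notin> reaching n (Suc (v + r)))"
      if "\<not> \<B> \<subseteq> KB"
    proof -
      from that have "\<B> - KB \<noteq> {}" by blast
      then obtain w where w: "Suc v \<le> w" "\<B> - KB \<subseteq> reaching n w" "\<exists>G\<in>\<B> - KB. G \<notin> reaching n (Suc w)"
        using reaching_extremal[OF rB] by metis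
      then show ?thesis by (intro exI[of _ "w - v"]) auto
    qed
    show thesis
    proof (cases "\<A> \<subseteq> KA")
      case AK: True
      show thesis
      proof (cases "\<B> \<subseteq> KB")
        case True
        with AK show thesis by (rule that(1))
      next
        case False
        then obtain s where "1 \<le> s" "\<B> - KB \<subseteq> reaching n (v + s)" "\<exists>G\<in>\<B> - KB. G \<notin> reaching n (Suc (v + s))"
          using B by blast
        then show thesis using that(3)[of s] AK by blast
      qed
    next
      case False
      then obtain r where r: "1 \<le> r" "\<A> - KA \<subseteq> reaching n (u + r)"
        "\<exists>F\<in>\<A> - KA. F \<notin> reaching n (Suc (u + r))" using A by blast
      show thesis
      proof (cases "\<B> \<subseteq> KB")
        case True
        then show thesis using that(2)[of r] r by blast
      next
        case False
        then obtain s where s: "1 \<le> s" "\<B> - KB \<subseteq> reaching n (v + s)"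
          "\<exists>G\<in>\<B> - KB. G \<notin> reaching n (Suc (v + s))" using B by blast
        show thesis
        proof (cases "r \<le> s")
          case True
          then have "reaching n (v + s) \<subseteq> reaching n (v + r)" by (intro reaching_mono) simp
          then show thesis using that(2)[of r] r s by blast
        next
          case False
          then have "reaching n (u + r) \<subseteq> reaching n (u + s)" by (intro reaching_mono) simp
          then show thesis using that(3)[of s] r s by blast
        qed
      qed
    qed
  qed
  then show ?thesis
  proof cases
    case 1
    have A: "mu n p \<A> \<le> mu n p KA" "mu n p \<B> \<le> mu n p KB"
      by (rule mu_mono[OF facts(3,5) K(1) 1(1)], rule mu_mono[OF facts(3,5) K(2) 1(2)])
    have KAB: "mu n p KA \<le> p ^ u" "mu n p KB \<le> p ^ v"
      unfolding KA_def KB_def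
      by (rule mu_window_le(1)[OF t p q ij(1) TT(1,3,4)], rule mu_window_le(1)[OF t p q ij(2) TT(2,3,4)])
    have pp: "p ^ u * p ^ v = p ^ (2 * t)" by (metis power_add TT(5))
    have nn: "0 \<le> mu n p \<A>" "0 \<le> mu n p \<B>" "0 < p ^ u" "0 < p ^ v"
      using facts(1) by (simp_all add: mu_nonneg[OF facts(3,5)])
    show ?thesis
    proof (cases "mu n p \<A> < p ^ u \<or> mu n p \<B> < p ^ v")
      case True
      then have "mu n p \<A> * mu n p \<B> < p ^ u * p ^ v"
      proof
        assume "mu n p \<A> < p ^ u"
        then have "mu n p \<A> * p ^ v < p ^ u * p ^ v" using nn by simp
        moreover have "mu n p \<A> * mu n p \<B> \<le> mu n p \<A> * p ^ v"
          using nn A KAB by (intro mult_left_mono) auto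
        ultimately show ?thesis by linarith
      next
        assume "mu n p \<B> < p ^ v"
        then have "p ^ u * mu n p \<B> < p ^ u * p ^ v" using nn by simp
        moreover have "mu n p \<A> * mu n p \<B> \<le> p ^ u * mu n p \<B>"
          using nn A KAB by (intro mult_right_mono) auto
        ultimately show ?thesis by linarith
      qed
      then show ?thesis using pp by simp
    next
      case False
      then have full: "p ^ u \<le> mu n p KA" "p ^ v \<le> mu n p KB" using A by linarith+
      have "mu n p KA \<le> mu n p \<A>" "mu n p KB \<le> mu n p \<B>" using False KAB by linarith+
      then have "\<A> = KA" "\<B> = KB"
        using mu_eq_imp_eq[OF facts(1,7) K(1) 1(1)] mu_eq_imp_eq[OF facts(1,7) K(2) 1(2)] by blast+
      moreover have "i = j"
      proof (rule ccontr)
        assume "i \<noteq> j"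
        then have "T < t + 2" using ij by (simp add: T_def)
        moreover have "i = 1 \<or> j = 1" using \<open>i \<noteq> j\<close> ij by auto
        ultimately have "mu n p KA < p ^ u \<or> mu n p KB < p ^ v"
          unfolding KA_def KB_def using mu_window_le(2)[OF t p q ij(1) TT(1,3,4)]
            mu_window_le(2)[OF t p q ij(2) TT(2,3,4)] by auto
        then show False using full by auto
      qed
      ultimately show ?thesis by (auto simp: KA_def KB_def T_def mult_2 add.assoc)
    qed
  next
    case (2 r)
    then obtain F where "F \<in> \<A>" "F \<notin> KA" "F \<notin> reaching n (Suc (u + r))" by auto
    then show ?thesis
      using product_less_refined[OF t p q sub m T_def TT(3) uv ij _ _ _ 2(1)] 2(3,4)
      unfolding KA_def KB_def by blast
  next
    case (3 r)
    then obtain G where "G \<in> \<B>" "G \<notin> KB" "G \<notin> reaching n (Suc (v + r))" by auto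
    moreover have "T = t + j + i" by (simp add: T_def)
    ultimately have "mu n p \<B> * mu n p \<A> < p ^ (2 * t)"
      using product_less_refined[OF t p q sub(2,1) meeting_sym[OF m] _ TT(3) uv(2,1) ij(2,1) _ _ _ 3(1)] 3(3,4)
      unfolding KA_def KB_def by blast
    then show ?thesis by (simp add: mult.commute)
  qed
qed

lemma meeting_product:
  assumes sub: "\<A> \<subseteq> Pow {1..n}" "\<B> \<subseteq> Pow {1..n}" and m: "meeting t n \<A> \<B>"
  shows "mu n p \<A> * mu n p \<B> < p ^ (2 * t) \<or>
    (\<exists>k\<le>1. t + 2 * k \<le> n \<and> \<A> = window_family n k {1..t + 2 * k} \<and> \<B> = window_family n k {1..t + 2 * k})"
proof (cases "\<A> = {} \<or> \<B> = {}")
  case True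
  then show ?thesis using pq_pos[OF t p q] by (auto simp: mu_def)
next
  case False
  have "p < 1" using p_bounds(2)[OF t p q] by simp
  note facts = pq_pos[OF t p q] this
  define a where "a = 1 / real t"
  have a: "0 < a" "a \<le> 1" using t by (auto simp: a_def)
  have a2t: "a ^ (2 * t) * (q ^ t)\<^sup>2 = p ^ (2 * t)"
    using power_ratio[OF t p q, of "2 * t"] by (simp add: a_def power_mult[symmetric] mult.commute)
  have "\<A> \<subseteq> reaching n 0" "\<B> \<subseteq> reaching n 0" using sub by (simp_all add: reaching_0)
  then obtain u v where u: "\<A> \<subseteq> reaching n u" "\<exists>F\<in>\<A>. F \<notin> reaching n (Suc u)"
    and v: "\<B> \<subseteq> reaching n v" "\<exists>G\<in>\<B>. G \<notin> reaching n (Suc v)"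
    using False reaching_extremal by metis
  have uv: "2 * t \<le> u + v"
  proof -
    obtain F G where "F \<in> \<A>" "F \<notin> reaching n (Suc u)" "G \<in> \<B>" "G \<notin> reaching n (Suc v)"
      using u(2) v(2) by blast
    then show ?thesis using sub by (intro meeting_levels[OF m]) auto
  qed
  have "mu n p \<A> \<le> mu n p (reaching n u)"
    using u(1) facts by (intro mu_mono) (auto simp: reaching_def)
  then have Au: "mu n p \<A> \<le> a ^ u" using mu_reaching_critical[OF t p q, of n u] by (simp add: a_def)
  have "mu n p \<B> \<le> mu n p (reaching n v)"
    using v(1) facts by (intro mu_mono) (auto simp: reaching_def)
  then have Bv: "mu n p \<B> \<le> a ^ v" using mu_reaching_critical[OF t p q, of n v] by (simp add: a_def)
  have nn: "0 \<le> mu n p \<A>" "0 \<le> mu n p \<B>" by (rule mu_nonneg[OF facts(3,5)])+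
  \<comment> \<open>The bounds of the first three cases below carry a^(2t), so only the remaining
    factor is compared with q^(2t).\<close>
  have small: "mu n p \<A> * mu n p \<B> < p ^ (2 * t)" if "mu n p \<A> * mu n p \<B> \<le> a ^ (2 * t) * c" "c < (q ^ t)\<^sup>2" for c
  proof -
    have "a ^ (2 * t) * c < a ^ (2 * t) * (q ^ t)\<^sup>2" using a that(2) by (intro mult_strict_left_mono) auto
    then show ?thesis using that(1) a2t by linarith
  qed
  define twice where "twice w F \<longleftrightarrow> (\<exists>k l. k < l \<and> l \<le> n \<and> int w \<le> height F k \<and> int w \<le> height F l)" for w F
  consider "2 * t < u + v"
    | "u + v = 2 * t" "\<forall>F\<in>\<A>. F \<notin> reaching n (Suc u) \<longrightarrow> twice u F"
    | "u + v = 2 * t" "\<forall>G\<in>\<B>. G \<notin> reaching n (Suc v) \<longrightarrow> twice v G"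
    | F G where "u + v = 2 * t" "F \<in> \<A>" "F \<notin> reaching n (Suc u)" "\<not> twice u F"
        "G \<in> \<B>" "G \<notin> reaching n (Suc v)" "\<not> twice v G"
  proof (cases "2 * t < u + v")
    case False
    then have eq: "u + v = 2 * t" using uv by simp
    show thesis using that(2-4)[OF eq] by blast
  qed (rule that(1))
  then show ?thesis
  proof cases
    case 1
    have "mu n p \<A> * mu n p \<B> \<le> a ^ u * a ^ v" using Au Bv nn a by (intro mult_mono) auto
    also have "\<dots> \<le> a ^ (2 * t + 1)"
      using 1 a by (simp only: power_add[symmetric]) (intro power_decreasing, auto)
    finally show ?thesis using small[of a] qt_squared(2)[OF t p q] by (simp add: a_def)
  next
    case 2
    have "mu n p \<A> \<le> 2 * p * a ^ u"
      unfolding a_def using sub 2(2) by (intro mu_le_if_twice[OF t p q]) (auto simp: twice_def)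
    then have "mu n p \<A> * mu n p \<B> \<le> (2 * p * a ^ u) * a ^ v"
      using Bv nn a facts by (intro mult_mono) auto
    also have "\<dots> = a ^ (2 * t) * (2 * p)" using 2(1) by (simp add: power_add[symmetric])
    finally show ?thesis using small[of "2 * p"] qt_squared(1)[OF t p q] by simp
  next
    case 3
    have "mu n p \<B> \<le> 2 * p * a ^ v"
      unfolding a_def using sub 3(2) by (intro mu_le_if_twice[OF t p q]) (auto simp: twice_def)
    then have "mu n p \<A> * mu n p \<B> \<le> a ^ u * (2 * p * a ^ v)"
      using Au nn a facts by (intro mult_mono) auto
    also have "\<dots> = a ^ (2 * t) * (2 * p)" using 3(1) by (simp add: power_add[symmetric])
    finally show ?thesis using small[of "2 * p"] qt_squared(1)[OF t p q] by simp
  next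
    case (4 F0 G0)
    obtain i j where ij: "t + i + j \<le> n" "u + i = t + j" "v + j = t + i"
      and F: "\<And>F. F \<in> \<A> \<Longrightarrow> F \<notin> reaching n (Suc u) \<Longrightarrow> card (F \<inter> {1..t + i + j}) = t + j"
      and G: "\<And>G. G \<in> \<B> \<Longrightarrow> G \<notin> reaching n (Suc v) \<Longrightarrow> card (G \<inter> {1..t + i + j}) = t + i"
      by (rule meeting_window[OF m sub 4(1-3) 4(4)[unfolded twice_def] 4(5,6) 4(7)[unfolded twice_def]]) (rule that)
    \<comment> \<open>Deficits at most 1 are separated because equality is attained for i = j = 0
      and i = j = 1.\<close>
    consider "i \<le> 1" "j \<le> 1" | "2 \<le> i" "j \<le> i" | "2 \<le> j" "i \<le> j" by linarith
    then show ?thesis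
    proof cases
      case 1
      then show ?thesis
        using product_less_one_window[OF sub m ij 1 F G] ij(1) by (auto simp: mult_2)
    next
      case 2
      then show ?thesis using product_less_crude[OF t p q sub ij 2 F G] by simp
    next
      case 3
      have ji: "t + j + i = t + i + j" by simp
      have "mu n p \<B> * mu n p \<A> < p ^ (2 * t)"
        by (rule product_less_crude[OF t p q sub(2,1) _ ij(3,2) 3]) (use ij F G in \<open>simp_all add: ji\<close>)
      then show ?thesis by (simp add: mult.commute)
    qed
  qed
qed

text \<open>Both families undergo the same shift, which preserves cross-intersection and both
  measures. A pair of windows after the shift is pulled back to a pair of windows before it.\<close>

lemma cross_intersecting_critical:
  assumes "\<A> \<subseteq> Pow {1..n}" "\<B> \<subseteq> Pow {1..n}" "cross_intersecting t \<A> \<B>"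
  shows "mu n p \<A> * mu n p \<B> < p ^ (2 * t) \<or>
    (\<exists>k\<le>1. \<exists>Y\<subseteq>{1..n}. card Y = t + 2 * k \<and> \<A> = window_family n k Y \<and> \<B> = window_family n k Y)"
  using assms
proof (induction "(\<Sum>F\<in>\<A>. \<Sum>F) + (\<Sum>F\<in>\<B>. \<Sum>F)" arbitrary: \<A> \<B> rule: less_induct)
  case less
  note sub = less.prems(1,2) and cr = less.prems(3)
  show ?case
  proof (cases "shifted n \<A> \<and> shifted n \<B>")
    case True
    then have "meeting t n \<A> \<B>" using shifted_imp_meeting cr sub by blast
    from meeting_product[OF sub this] show ?thesis
    proof (rule disj_forward)
      assume "\<exists>k\<le>1. t + 2 * k \<le> n \<and> \<A> = window_family n k {1..t + 2 * k} \<and> \<B> = window_family n k {1..t + 2 * k}"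
      then obtain k where k: "k \<le> 1" "t + 2 * k \<le> n" "\<A> = window_family n k {1..t + 2 * k}"
        "\<B> = window_family n k {1..t + 2 * k}" by blast
      then have "{1..t + 2 * k} \<subseteq> {1..n}" "card {1..t + 2 * k} = t + 2 * k" by auto
      then show "\<exists>k\<le>1. \<exists>Y\<subseteq>{1..n}. card Y = t + 2 * k \<and> \<A> = window_family n k Y \<and> \<B> = window_family n k Y"
        using k by metis
    qed
  next
    case False
    then obtain x y where xy: "1 \<le> x" "x < y" "y \<le> n"
      and bad: "(\<exists>F\<in>\<A>. y \<in> F \<and> x \<notin> F \<and> swap_elem x y F \<notin> \<A>) \<or>
        (\<exists>F\<in>\<B>. y \<in> F \<and> x \<notin> F \<and> swap_elem x y F \<notin> \<B>)"
      unfolding shifted_def by blast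
    let ?A = "shift x y \<A>" and ?B = "shift x y \<B>"
    have xn: "x \<in> {1..n}" "y \<in> {1..n}" "x \<noteq> y" using xy by auto
    have sub': "?A \<subseteq> Pow {1..n}" "?B \<subseteq> Pow {1..n}" using shift_subset sub xn by blast+
    have "(\<Sum>F\<in>?A. \<Sum>F) + (\<Sum>F\<in>?B. \<Sum>F) < (\<Sum>F\<in>\<A>. \<Sum>F) + (\<Sum>F\<in>\<B>. \<Sum>F)"
      using bad sum_shift[OF sub(1) xy(2)] sum_shift[OF sub(2) xy(2)]
      by (meson add_le_less_mono add_less_le_mono)
    then have "mu n p ?A * mu n p ?B < p ^ (2 * t) \<or>
      (\<exists>k\<le>1. \<exists>Y\<subseteq>{1..n}. card Y = t + 2 * k \<and> ?A = window_family n k Y \<and> ?B = window_family n k Y)"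
      using less.hyps sub' cross_intersecting_shift[OF cr sub xn(3)] by blast
    then show ?thesis
    proof
      assume "mu n p ?A * mu n p ?B < p ^ (2 * t)"
      then show ?thesis using mu_shift[OF sub(1)] mu_shift[OF sub(2)] by simp
    next
      assume "\<exists>k\<le>1. \<exists>Y\<subseteq>{1..n}. card Y = t + 2 * k \<and> ?A = window_family n k Y \<and> ?B = window_family n k Y"
      then obtain k Y where Y: "k \<le> 1" "Y \<subseteq> {1..n}" "card Y = t + 2 * k"
        "?A = window_family n k Y" "?B = window_family n k Y" by blast
      consider "k = 0" | "k = 1" using Y(1) by linarith
      then have "\<exists>Y'\<subseteq>{1..n}. card Y' = t + 2 * k \<and> \<A> = window_family n k Y' \<and> \<B> = window_family n k Y'"
      proof cases
        case 1
        then show ?thesis using unshift_window_0[OF cr sub Y(2)] Y t by simp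
      next
        case 2
        then show ?thesis using unshift_window_1[OF cr sub Y(2) _ _ xn] Y t by simp
      qed
      then show ?thesis using Y(1) by blast
    qed
  qed
qed

end

subsection \<open>Reduction to the critical probability\<close>

text \<open>Majorisation: p a and b lie between p b and p a + (1 - p) b, and both pairs have the
  same sum, so convexity compares the sums of the \<open>s\<close>-th powers.\<close>

lemma powr_two_point:
  fixes a b p s :: real
  assumes "0 \<le> b" "b \<le> a" "0 < p" "p < 1" "1 \<le> s"
  shows "p powr s * a powr s + (1 - p powr s) * b powr s \<le> (p * a + (1 - p) * b) powr s"
proof (cases "b = 0 \<or> a = b")
  case True
  then show ?thesis
  proof
    assume "b = 0"
    then show ?thesis using assms by (simp add: powr_mult)
  next
    assume "a = b"
    then show ?thesis by (simp add: algebra_simps)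
  qed
next
  case False
  then have b: "0 < b" "b < a" using assms by auto
  define lo where "lo = p * b"
  define hi where "hi = p * a + (1 - p) * b"
  have pos: "lo \<in> {0<..}" "hi \<in> {0<..}" using assms b by (auto simp: lo_def hi_def intro!: add_pos_pos)
  have d: "hi - lo = p * (a - b) + (1 - p) * b" by (simp add: lo_def hi_def algebra_simps)
  have d0: "0 < hi - lo" unfolding d using assms b by (intro add_pos_pos mult_pos_pos) auto
  \<comment> \<open>The barycentric coordinate of p a between the end points; that of b is 1 - u
    because the sums agree.\<close>
  define u where "u = p * (a - b) / (hi - lo)"
  have u: "0 \<le> u" "u \<le> 1" using d0 assms b by (auto simp: u_def d)
  have ud: "u * (hi - lo) = p * (a - b)" using d0 by (simp add: u_def)
  have m1: "(1 - u) *\<^sub>R lo + u *\<^sub>R hi = p * a"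
    using ud by (simp add: lo_def algebra_simps)
  have m2: "(1 - (1 - u)) *\<^sub>R lo + (1 - u) *\<^sub>R hi = b"
  proof -
    have "(1 - (1 - u)) *\<^sub>R lo + (1 - u) *\<^sub>R hi = hi - u * (hi - lo)" by (simp add: algebra_simps)
    then show ?thesis using ud by (simp add: hi_def algebra_simps)
  qed
  note convex = convex_onD[OF powr_convex[OF assms(5)] _ _ pos]
  have "(p * a) powr s \<le> (1 - u) * lo powr s + u * hi powr s"
    using convex[of u] u m1 by simp
  moreover have "b powr s \<le> (1 - (1 - u)) * lo powr s + (1 - u) * hi powr s"
    using convex[of "1 - u"] u m2 by simp
  ultimately have "(p * a) powr s + b powr s \<le> lo powr s + hi powr s"
    by (simp add: algebra_simps)
  then show ?thesis using assms b by (simp add: lo_def hi_def powr_mult algebra_simps)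
qed

section \<open>Increasing families at different probabilities\<close>

definition up_closed :: "nat \<Rightarrow> nat set set \<Rightarrow> bool" where
  "up_closed n \<A> \<longleftrightarrow> (\<forall>F\<in>\<A>. \<forall>G. F \<subseteq> G \<longrightarrow> G \<subseteq> {1..n} \<longrightarrow> G \<in> \<A>)"

lemma mu_Suc:
  assumes "\<A> \<subseteq> Pow {1..Suc n}"
  shows "mu (Suc n) p \<A> = p * mu n p {F. F \<subseteq> {1..n} \<and> insert (Suc n) F \<in> \<A>}
    + (1 - p) * mu n p {F. F \<subseteq> {1..n} \<and> F \<in> \<A>}"
proof -
  let ?A1 = "{F. F \<subseteq> {1..n} \<and> insert (Suc n) F \<in> \<A>}"
  let ?A0 = "{F. F \<subseteq> {1..n} \<and> F \<in> \<A>}"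
  have fin: "finite ?A1" "finite ?A0" by (auto intro!: finite_family[of _ n])
  have eq: "\<A> = ?A0 \<union> insert (Suc n) ` ?A1"
  proof (intro equalityI subsetI)
    fix F assume F: "F \<in> \<A>"
    show "F \<in> ?A0 \<union> insert (Suc n) ` ?A1"
    proof (cases "Suc n \<in> F")
      case True
      then have "F = insert (Suc n) (F - {Suc n})" by auto
      moreover have "F - {Suc n} \<in> ?A1"
        using F assms True by (auto simp: insert_absorb atLeastAtMostSuc_conv)
      ultimately show ?thesis by blast
    next
      case False
      then show ?thesis using F assms by (auto simp: atLeastAtMostSuc_conv)
    qed
  qed auto
  have inj: "inj_on (insert (Suc n)) ?A1"
  proof (rule inj_onI)
    fix F G assume "F \<in> ?A1" "G \<in> ?A1" and e: "insert (Suc n) F = insert (Suc n) G"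
    then have "Suc n \<notin> F" "Suc n \<notin> G" by auto
    then show "F = G" using e by (metis insert_ident)
  qed
  have "?A0 \<inter> insert (Suc n) ` ?A1 = {}" by auto
  then have "mu (Suc n) p (?A0 \<union> insert (Suc n) ` ?A1)
      = (\<Sum>F\<in>?A0. weight (Suc n) p F) + (\<Sum>F\<in>?A1. weight (Suc n) p (insert (Suc n) F))"
    unfolding mu_def using fin by (subst sum.union_disjoint) (auto simp only: sum.reindex[OF inj] o_def)
  also have "(\<Sum>F\<in>?A0. weight (Suc n) p F) = (1 - p) * mu n p ?A0"
    unfolding mu_def sum_distrib_left by (rule sum.cong) (auto intro!: weight_stay)
  also have "(\<Sum>F\<in>?A1. weight (Suc n) p (insert (Suc n) F)) = p * mu n p ?A1"
    unfolding mu_def sum_distrib_left by (rule sum.cong) (auto intro!: weight_insert)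
  finally show ?thesis using eq by simp
qed

text \<open>Induction on the last element. Up-closedness gives \<open>?A0 \<subseteq> ?A1\<close>,
  which is the order b \<le> a required by \<open>powr_two_point\<close>. The comparison is sharp
  for \<open>window_family n 0 Y\<close>, whose measure is p^(card Y), so the bound p^(2t) is
  carried over without loss.\<close>

lemma mu_powr_le:
  assumes "0 < p" "p < 1" "1 \<le> s" "\<A> \<subseteq> Pow {1..n}" "up_closed n \<A>"
  shows "mu n (p powr s) \<A> \<le> mu n p \<A> powr s"
  using assms(4,5)
proof (induction n arbitrary: \<A>)
  case 0
  then have "\<A> = {} \<or> \<A> = {{}}" by auto
  then show ?case by (auto simp: mu_def weight_def)
next
  case (Suc n)
  let ?A1 = "{F. F \<subseteq> {1..n} \<and> insert (Suc n) F \<in> \<A>}"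
  let ?A0 = "{F. F \<subseteq> {1..n} \<and> F \<in> \<A>}"
  have sub: "?A0 \<subseteq> Pow {1..n}" "?A1 \<subseteq> Pow {1..n}" by auto
  have up: "up_closed n ?A0" "up_closed n ?A1"
  proof -
    show "up_closed n ?A0"
      unfolding up_closed_def
    proof (intro ballI allI impI)
      fix F G assume "F \<in> ?A0" "F \<subseteq> G" "G \<subseteq> {1..n}"
      moreover from this have "G \<subseteq> {1..Suc n}" by auto
      ultimately show "G \<in> ?A0" using Suc.prems(2) unfolding up_closed_def by blast
    qed
    show "up_closed n ?A1"
      unfolding up_closed_def
    proof (intro ballI allI impI)
      fix F G assume "F \<in> ?A1" "F \<subseteq> G" "G \<subseteq> {1..n}"
      moreover from this have "insert (Suc n) F \<subseteq> insert (Suc n) G" "insert (Suc n) G \<subseteq> {1..Suc n}"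
        by auto
      ultimately show "G \<in> ?A1" using Suc.prems(2) unfolding up_closed_def by blast
    qed
  qed
  have "?A0 \<subseteq> ?A1"
  proof
    fix F assume F: "F \<in> ?A0"
    then have "insert (Suc n) F \<subseteq> {1..Suc n}" by auto
    then show "F \<in> ?A1" using F Suc.prems(2) unfolding up_closed_def by blast
  qed
  then have le: "0 \<le> mu n p ?A0" "mu n p ?A0 \<le> mu n p ?A1"
    using assms(1,2) mu_nonneg[of p n] mu_mono[OF _ _ sub(2)] by auto
  have P: "0 < p powr s" "p powr s \<le> 1" using assms by (auto intro: powr_le1)
  have "mu (Suc n) (p powr s) \<A> = p powr s * mu n (p powr s) ?A1 + (1 - p powr s) * mu n (p powr s) ?A0"
    by (rule mu_Suc[OF Suc.prems(1)])
  also have "\<dots> \<le> p powr s * mu n p ?A1 powr s + (1 - p powr s) * mu n p ?A0 powr s"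
    using P Suc.IH[OF sub(1) up(1)] Suc.IH[OF sub(2) up(2)] by (intro add_mono mult_left_mono) auto
  also have "\<dots> \<le> (p * mu n p ?A1 + (1 - p) * mu n p ?A0) powr s"
    using assms(1-3) le by (intro powr_two_point) auto
  also have "\<dots> = mu (Suc n) p \<A> powr s" by (simp only: mu_Suc[OF Suc.prems(1)])
  finally show ?case .
qed

definition up_closure :: "nat \<Rightarrow> nat set set \<Rightarrow> nat set set" where
  "up_closure n \<A> = {G. G \<subseteq> {1..n} \<and> (\<exists>F\<in>\<A>. F \<subseteq> G)}"

lemma up_closure:
  assumes "\<A> \<subseteq> Pow {1..n}"
  shows "\<A> \<subseteq> up_closure n \<A>" "up_closure n \<A> \<subseteq> Pow {1..n}" "up_closed n (up_closure n \<A>)"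
proof -
  show "\<A> \<subseteq> up_closure n \<A>" using assms by (auto simp: up_closure_def)
  show "up_closure n \<A> \<subseteq> Pow {1..n}" by (auto simp: up_closure_def)
  show "up_closed n (up_closure n \<A>)"
    unfolding up_closed_def up_closure_def by (blast intro: subset_trans)
qed

lemma cross_intersecting_up_closure:
  assumes "cross_intersecting t \<A> \<B>"
  shows "cross_intersecting t (up_closure n \<A>) (up_closure n \<B>)"
  unfolding cross_intersecting_def
proof (intro ballI)
  fix F G assume FG: "F \<in> up_closure n \<A>" "G \<in> up_closure n \<B>"
  then obtain F' G' where "F' \<in> \<A>" "F' \<subseteq> F" "G' \<in> \<B>" "G' \<subseteq> G" by (auto simp: up_closure_def)
  moreover have "finite (F \<inter> G)" using FG by (auto simp: up_closure_def intro: finite_subset)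
  ultimately have "t \<le> card (F' \<inter> G')" "card (F' \<inter> G') \<le> card (F \<inter> G)"
    using assms by (auto simp: cross_intersecting_def intro!: card_mono)
  then show "t \<le> card (F \<inter> G)" by simp
qed

text \<open>For k = 1 the quotient by p^t is 1 - (1 - p) (1 - (t + 1) p), so the deficit vanishes
  only at the critical probability.\<close>

lemma mu_window_family:
  assumes "0 < p" "p < 1" "Y \<subseteq> {1..n}" "card Y = t + 2 * k" "k \<le> 1" "p \<le> 1 / (real t + 1)"
  shows "mu n p (window_family n k Y) \<le> p ^ t"
    and "mu n p (window_family n k Y) = p ^ t \<longleftrightarrow> k = 0 \<or> p = 1 / (real t + 1)"
proof -
  have n: "t + 2 * k \<le> n" using card_mono[OF _ assms(3)] assms(4) by simp
  have eq: "mu n p (window_family n k Y) = mu n p (window_family n k {1..t + 2 * k})"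
    by (rule mu_window_family_cong[OF assms(3,4)])
  have "mu n p (window_family n k Y) \<le> p ^ t \<and>
    (mu n p (window_family n k Y) = p ^ t \<longleftrightarrow> k = 0 \<or> p = 1 / (real t + 1))"
  proof (cases "k = 0")
    case True
    then show ?thesis using eq mu_window_0[of p t n] n assms(1,2) by simp
  next
    case False
    then have k: "k = 1" using assms(5) by simp
    have "mu n p (window_family n k Y) = p ^ t * (p ^ 2 + (real t + 2) * p * (1 - p))"
      using eq mu_window_1[of p "t + 2" n] n assms(1,2) k
      by (simp add: power2_eq_square algebra_simps)
    also have "p ^ 2 + (real t + 2) * p * (1 - p) = 1 - (1 - p) * (1 - (real t + 1) * p)"
      by (simp add: power2_eq_square algebra_simps)
    finally have m: "mu n p (window_family n k Y) = p ^ t - p ^ t * ((1 - p) * (1 - (real t + 1) * p))"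
      by (simp add: algebra_simps)
    have "(real t + 1) * p \<le> 1" using assms(6) by (simp add: field_simps)
    then have "0 \<le> p ^ t * ((1 - p) * (1 - (real t + 1) * p))"
      using assms(1,2) by (intro mult_nonneg_nonneg) auto
    moreover have "p ^ t * ((1 - p) * (1 - (real t + 1) * p)) = 0 \<longleftrightarrow> p = 1 / (real t + 1)"
    proof -
      have "p ^ t * ((1 - p) * (1 - (real t + 1) * p)) = 0 \<longleftrightarrow> (real t + 1) * p = 1"
        using assms(1,2) by auto
      also have "\<dots> \<longleftrightarrow> p = 1 / (real t + 1)" by (simp add: eq_divide_eq mult.commute)
      finally show ?thesis .
    qed
    ultimately show ?thesis using m False by simp
  qed
  then show "mu n p (window_family n k Y) \<le> p ^ t"
    "mu n p (window_family n k Y) = p ^ t \<longleftrightarrow> k = 0 \<or> p = 1 / (real t + 1)" by auto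
qed

lemma mult_less_square:
  fixes x y m :: real
  assumes "0 \<le> x" "0 \<le> y" "x \<le> m" "y \<le> m" "x < m \<or> y < m"
  shows "x * y < m * m"
proof (cases "x < m")
  case True
  have "x * y \<le> x * m" using assms by (intro mult_left_mono) auto
  also have "\<dots> < m * m" using True assms by (intro mult_strict_right_mono) auto
  finally show ?thesis .
next
  case False
  have "x * y \<le> m * y" using assms by (intro mult_right_mono) auto
  also have "\<dots> < m * m" using False assms by (intro mult_strict_left_mono) auto
  finally show ?thesis .
qed

text \<open>Up-closing only enlarges the families. A strict inequality at \<open>p0\<close> passes
  to p through \<open>mu_powr_le\<close>; if instead the closures are windows, they are measured at
  p directly, and a family that differs from its closure loses mass.\<close>

lemma cross_intersecting_dichotomy:
  assumes t: "14 \<le> t" and p: "0 < p" "p \<le> 1 / (real t + 1)"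
    and sub: "\<A> \<subseteq> Pow {1..n}" "\<B> \<subseteq> Pow {1..n}" and cr: "cross_intersecting t \<A> \<B>"
  shows "mu n p \<A> * mu n p \<B> < p ^ (2 * t) \<or>
    (\<exists>k\<le>1. \<exists>Y\<subseteq>{1..n}. card Y = t + 2 * k \<and> \<A> = window_family n k Y \<and> \<B> = window_family n k Y \<and>
      (k = 0 \<or> p = 1 / (real t + 1)))"
proof -
  define p0 where "p0 = 1 / (real t + 1)"
  define A where "A = up_closure n \<A>"
  define B where "B = up_closure n \<B>"
  have p0: "0 < p0" "p0 < 1" "p \<le> p0" using t p by (auto simp: p0_def)
  then have p1: "p < 1" by simp
  have A: "\<A> \<subseteq> A" "A \<subseteq> Pow {1..n}" "up_closed n A" using up_closure[OF sub(1)] by (auto simp: A_def)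
  have B: "\<B> \<subseteq> B" "B \<subseteq> Pow {1..n}" "up_closed n B" using up_closure[OF sub(2)] by (auto simp: B_def)
  have "cross_intersecting t A B" unfolding A_def B_def by (rule cross_intersecting_up_closure[OF cr])
  then have "mu n p0 A * mu n p0 B < p0 ^ (2 * t) \<or>
    (\<exists>k\<le>1. \<exists>Y\<subseteq>{1..n}. card Y = t + 2 * k \<and> A = window_family n k Y \<and> B = window_family n k Y)"
    using cross_intersecting_critical[OF t p0_def refl A(2) B(2)] by simp
  moreover have nn: "0 \<le> mu n r \<C>" if "0 < r" "r < 1" for \<C> r using that by (simp add: mu_nonneg)
  have le: "mu n p \<A> \<le> mu n p A" "mu n p \<B> \<le> mu n p B"
    using mu_mono[of p A n \<A>] mu_mono[of p B n \<B>] A B p p1 by auto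
  ultimately show ?thesis
  proof (elim disjE)
    assume less: "mu n p0 A * mu n p0 B < p0 ^ (2 * t)"
    define s where "s = ln p / ln p0"
    have ln0: "ln p0 < 0" using p0 by simp
    have "ln p \<le> ln p0" using p p0 by simp
    then have s: "1 \<le> s" using ln0 by (simp add: s_def le_divide_eq)
    have ps: "p = p0 powr s" using p p0 ln0 by (simp add: s_def powr_def)
    have "mu n p \<A> * mu n p \<B> \<le> mu n p A * mu n p B"
      using le p p1 nn by (intro mult_mono) auto
    also have "\<dots> \<le> mu n p0 A powr s * mu n p0 B powr s"
      using mu_powr_le[OF p0(1,2) s A(2,3)] mu_powr_le[OF p0(1,2) s B(2,3)] nn[OF p(1) p1]
      by (intro mult_mono) (auto simp: ps)
    also have "\<dots> = (mu n p0 A * mu n p0 B) powr s" using p0 nn by (simp add: powr_mult)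
    also have "\<dots> < (p0 ^ (2 * t)) powr s"
      using less s p0 nn by (intro powr_less_mono2) auto
    also have "\<dots> = p ^ (2 * t)"
      using p0 by (simp add: ps powr_realpow[symmetric] powr_powr mult.commute)
    finally show ?thesis by simp
  next
    assume "\<exists>k\<le>1. \<exists>Y\<subseteq>{1..n}. card Y = t + 2 * k \<and> A = window_family n k Y \<and> B = window_family n k Y"
    then obtain k Y where kY: "k \<le> 1" "Y \<subseteq> {1..n}" "card Y = t + 2 * k"
      "A = window_family n k Y" "B = window_family n k Y" by blast
    define m where "m = mu n p (window_family n k Y)"
    have m: "m \<le> p ^ t" "m = p ^ t \<longleftrightarrow> k = 0 \<or> p = 1 / (real t + 1)"
      unfolding m_def by (rule mu_window_family[OF p(1) p1 kY(2,3,1) p(2)])+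
    have le': "mu n p \<A> \<le> m" "mu n p \<B> \<le> m" using le kY by (simp_all add: m_def)
    have sq: "p ^ (2 * t) = p ^ t * p ^ t" by (simp add: mult_2 power_add)
    show ?thesis
    proof (cases "\<A> = A \<and> \<B> = B \<and> m = p ^ t")
      case True
      then show ?thesis using kY m by blast
    next
      case False
      have "mu n p \<A> < p ^ t \<or> mu n p \<B> < p ^ t"
      proof (cases "m = p ^ t")
        case True
        then have "\<A> \<noteq> A \<or> \<B> \<noteq> B" using False by simp
        then have "mu n p \<A> < m \<or> mu n p \<B> < m"
          using mu_eq_imp_eq[OF p(1) p1 A(2,1)] mu_eq_imp_eq[OF p(1) p1 B(2,1)] kY
          unfolding m_def by force
        then show ?thesis using m by auto
      qed (use le' m(1) in auto)
      then have "mu n p \<A> * mu n p \<B> < p ^ t * p ^ t"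
        using le' m nn[OF p(1) p1] by (intro mult_less_square) auto
      then show ?thesis by (simp add: sq)
    qed
  qed
qed

section \<open>Translation to Frankl families\<close>

lemma frankl_family_eq_window_family: "frankl_family t i n = window_family n i {1..t + 2 * i}"
  by (auto simp: frankl_family_def window_family_def)

lemma le_and_eq_iff: "x < y \<or> P \<Longrightarrow> (P \<Longrightarrow> x = y) \<Longrightarrow> x \<le> y \<and> (x = y \<longleftrightarrow> P)"
  for x y :: real
  by auto

text \<open>The clause \<open>t + 2 \<le> n\<close> matters: for n = t + 1 the formula of
  \<open>frankl_family t 1 n\<close> yields only the full set, and for n = t the empty family, and
  both products are below p^(2t).\<close>

theorem theorem1p3:
  fixes t n :: nat and p :: real and \<A> \<B> :: "nat set set"
  assumes "t \<ge> 14" and "n \<ge> t"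
    and "0 < p" and "p \<le> 1 / (real t + 1)"
    and "\<A> \<subseteq> Pow {1..n}" and "\<B> \<subseteq> Pow {1..n}"
    and "cross_intersecting t \<A> \<B>"
  shows "mu n p \<A> * mu n p \<B> \<le> p ^ (2 * t) \<and>
    (mu n p \<A> * mu n p \<B> = p ^ (2 * t) \<longleftrightarrow>
      (\<A> = \<B> \<and> isomorphic_families n \<B> (frankl_family t 0 n)) \<or>
      (p = 1 / (real t + 1) \<and> t + 2 \<le> n \<and>
        \<A> = \<B> \<and> isomorphic_families n \<B> (frankl_family t 1 n)))"
proof -
  let ?ext = "\<lambda>k. \<exists>Y\<subseteq>{1..n}. card Y = t + 2 * k \<and> \<A> = window_family n k Y \<and> \<B> = window_family n k Y"
  have "1 / (real t + 1) < 1" using assms(1) by simp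
  then have p1: "p < 1" using assms(4) by linarith
  have prod_eq: "mu n p \<A> * mu n p \<B> = p ^ (2 * t)"
    if "?ext k" "k \<le> 1" "k = 0 \<or> p = 1 / (real t + 1)" for k
    using that mu_window_family(2)[OF assms(3) p1 _ _ that(2) assms(4)]
    by (auto simp: mult_2 power_add)
  have iso: "(\<A> = \<B> \<and> isomorphic_families n \<B> (frankl_family t k n)) \<longleftrightarrow> ?ext k"
    if "t + 2 * k \<le> n" for k
  proof
    assume "\<A> = \<B> \<and> isomorphic_families n \<B> (frankl_family t k n)"
    then show "?ext k"
      using isomorphic_window_family[of n \<B> k "t + 2 * k"] that
      unfolding frankl_family_eq_window_family by blast
  next
    assume "?ext k"
    then show "\<A> = \<B> \<and> isomorphic_families n \<B> (frankl_family t k n)"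
      using window_family_isomorphic[of _ n "t + 2 * k" k] that
      unfolding frankl_family_eq_window_family by blast
  qed
  have ext_le: "t + 2 * k \<le> n" if "?ext k" for k
    using that by (metis card_atLeastAtMost card_mono diff_Suc_1 finite_atLeastAtMost)
  have dich: "mu n p \<A> * mu n p \<B> < p ^ (2 * t) \<or> ?ext 0 \<or> p = 1 / (real t + 1) \<and> ?ext 1"
  proof (rule disj_forward[OF cross_intersecting_dichotomy[OF assms(1,3-7)]])
    assume "\<exists>k\<le>1. \<exists>Y\<subseteq>{1..n}. card Y = t + 2 * k \<and> \<A> = window_family n k Y \<and> \<B> = window_family n k Y \<and>
      (k = 0 \<or> p = 1 / (real t + 1))"
    then obtain k where k: "k \<le> 1" "?ext k" "k = 0 \<or> p = 1 / (real t + 1)" by blast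
    then consider "k = 0" | "k = 1" by linarith
    then show "?ext 0 \<or> p = 1 / (real t + 1) \<and> ?ext 1" by cases (use k in auto)
  qed
  have extremal: "mu n p \<A> * mu n p \<B> = p ^ (2 * t)" if "?ext 0 \<or> p = 1 / (real t + 1) \<and> ?ext 1"
    using that prod_eq[of 0] prod_eq[of 1] by auto
  have main: "mu n p \<A> * mu n p \<B> \<le> p ^ (2 * t) \<and>
    (mu n p \<A> * mu n p \<B> = p ^ (2 * t) \<longleftrightarrow> ?ext 0 \<or> p = 1 / (real t + 1) \<and> ?ext 1)"
    by (rule le_and_eq_iff[OF dich extremal])
  have "?ext 0 \<longleftrightarrow> \<A> = \<B> \<and> isomorphic_families n \<B> (frankl_family t 0 n)"
    using iso[of 0] assms(2) by simp
  moreover have "?ext 1 \<longleftrightarrow> t + 2 \<le> n \<and> \<A> = \<B> \<and> isomorphic_families n \<B> (frankl_family t 1 n)"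
    using iso[of 1] ext_le[of 1] by auto
  ultimately show ?thesis using main by blast
qed

end
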